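(* Let $p>1$ and assume that all the reward distributions have finite $p$th order moment, i.e. $\mathbb E[|X_n(1)|^p]<\infty$ for $1\le n\le N$. Choose a constant $v>0$. Construct the exploration sequence as follows: for each $t>1$, $t$ is included in $\mathcal A(t)$ if and only if $|\mathcal A(t-1)|<v\,t^{1/p}$ in the case $1<p\le2$, respectively if and only if $|\mathcal A(t-1)|<v\,t^{\frac{1}{1+p/2}}$ in the case $p>2$. Then the resulting DSEE policy $\pi^p$ has regret, as $T\to\infty$, $$R_T^{\pi^p}(\mathcal F)\le\begin{cases}O(T^{1/p}) & \text{if }1<p\le2,\\ O(T^{\frac{1}{1+p/2}}) & \text{if }p>2.\end{cases}$$
   Context: Bandit model: there are $N\ge2$ independent arms. Playing arm $n$ at time $t\in\{1,2,\dots\}$ yields a reward $X_n(t)$; for each $n$ the rewards $X_n(1),X_n(2),\dots$ are i.i.d. with unknown distribution $f_n$ and finite mean $\theta_n=\mathbb E[X_n(t)]$. Write $\mathcal F=(f_1,\dots,f_N)$. Let $\sigma$ be a permutation of $\{1,\dots,N\}$ with $\theta_{\sigma(1)}\ge\cdots\ge\theta_{\sigma(N)}$. At each time a single player plays one arm, chosen by a policy $\pi$ from past observations and decisions. The regret is $R_T^\pi(\mathcal F)=T\theta_{\sigma(1)}-\mathbb E_\pi[\sum_{t=1}^T X_\pi(t)]$, where $X_\pi(t)$ is the reward obtained at time $t$ under $\pi$. The constant implied in $O(\cdot)$ may depend on $\mathcal F$, $N$, $p$ and $v$, but not on $T$. DSEE policy: $\mathcal A(t)\subseteq\{1,\dots,t\}$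 denotes the (deterministic) set of exploration times up to and including $t$, so $\mathcal A(t)$ equals $\mathcal A(t-1)$ or $\mathcal A(t-1)\cup\{t\}$, with $\mathcal A(0)=\mathcal A(1)=\emptyset$. For positive integers $k,l$ put $k\oslash l=((k-1)\bmod l)+1$. Let $\overline\theta_n(t)$ be the sample mean of arm $n$ computed from the observations of arm $n$ at times in $\mathcal A(t-1)$ (arbitrary if there are none). At time $t$: if $t\in\mathcal A(t)$, play arm $|\mathcal A(t)|\oslash N$; if $t\notin\mathcal A(t)$, play an arm maximizing $\overline\theta_n(t)$ over $1\le n\le N$ (ties broken arbitrarily). *)

theory Defs
  imports "HOL-Probability.Probability" "HOL-Combinatorics.Permutations" "HOL-Library.Landau_Symbols"
begin

section \<open>The bandit model\<close>

text \<open>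
  Arms are \<open>1, \<dots>, N\<close> and times are \<open>1, 2, \<dots>\<close>; \<open>X n t \<omega>\<close> is the reward of arm \<open>n\<close> at time \<open>t\<close>
  and \<open>f n\<close> its law. The random variable \<open>U\<close>, with values in an arbitrary measurable space \<open>S\<close>,
  is external randomness, independent of all rewards, that a policy may use (for example, to
  break ties); deterministic policies ignore it.
\<close>

locale bandit = prob_space M
  for M :: "'a measure" +
  fixes S :: "'u measure" and U :: "'a \<Rightarrow> 'u"
    and N :: nat and f :: "nat \<Rightarrow> real measure" and X :: "nat \<Rightarrow> nat \<Rightarrow> 'a \<Rightarrow> real"
  assumes rewards_indep:
      "indep_vars (\<lambda>_. borel) (\<lambda>(n, t). X n t) ({1..N} \<times> {1..})"
    and rewards_distr:
      "\<And>n t. n \<in> {1..N} \<Longrightarrow> t \<ge> 1 \<Longrightarrow> distr M borel (X n t) = f n"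
    and rewards_integrable:
      "\<And>n t. n \<in> {1..N} \<Longrightarrow> t \<ge> 1 \<Longrightarrow> integrable M (X n t)"
    and seed_measurable: "U \<in> M \<rightarrow>\<^sub>M S"
    and seed_indep:
      "indep_set {U -` B \<inter> space M |B. B \<in> sets S}
         {(\<lambda>\<omega>. \<lambda>(n, t)\<in>{1..N} \<times> {1..}. X n t \<omega>) -` B \<inter> space M |B.
            B \<in> sets (Pi\<^sub>M ({1..N} \<times> {1..}) (\<lambda>_. borel))}"

definition arm_mean :: "(nat \<Rightarrow> real measure) \<Rightarrow> nat \<Rightarrow> real" where
  "arm_mean f n = (\<integral>x. x \<partial>f n)"

section \<open>Policies and regret\<close>

text \<open>The history before time \<open>t\<close> maps each \<open>s \<in> {1..<t}\<close> to the arm played and the reward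
  observed at time \<open>s\<close>.\<close>

type_synonym history = "nat \<Rightarrow> nat \<times> real"

definition history_space :: "nat \<Rightarrow> history measure" where
  "history_space t = Pi\<^sub>M {1..<t} (\<lambda>_. count_space UNIV \<Otimes>\<^sub>M borel)"

definition is_policy :: "nat \<Rightarrow> 'u measure \<Rightarrow> (nat \<Rightarrow> 'u \<Rightarrow> history \<Rightarrow> nat) \<Rightarrow> bool" where
  "is_policy N S \<pi> \<longleftrightarrow>
     (\<forall>t\<ge>1. (\<lambda>(u, h). \<pi> t u h) \<in> S \<Otimes>\<^sub>M history_space t \<rightarrow>\<^sub>M count_space {1..N})"

text \<open>The arm played at time \<open>t\<close> for a given seed \<open>u\<close> and table \<open>x\<close> of rewards. The third argument
  of \<open>\<pi>\<close> is the restriction of the history to \<open>{1..<t}\<close>, an element of the product space.\<close>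

fun played :: "(nat \<Rightarrow> 'u \<Rightarrow> history \<Rightarrow> nat) \<Rightarrow> 'u \<Rightarrow> (nat \<Rightarrow> nat \<Rightarrow> real) \<Rightarrow> nat \<Rightarrow> nat" where
  "played \<pi> u x t =
     \<pi> t u (\<lambda>s. if s \<in> {1..<t} then (played \<pi> u x s, x (played \<pi> u x s) s) else undefined)"

declare played.simps [simp del]

definition policy_reward ::
  "(nat \<Rightarrow> 'u \<Rightarrow> history \<Rightarrow> nat) \<Rightarrow> ('a \<Rightarrow> 'u) \<Rightarrow> (nat \<Rightarrow> nat \<Rightarrow> 'a \<Rightarrow> real) \<Rightarrow> nat \<Rightarrow> 'a \<Rightarrow> real" where
  "policy_reward \<pi> U X t \<omega> = X (played \<pi> (U \<omega>) (\<lambda>n s. X n s \<omega>) t) t \<omega>"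

text \<open>\<open>\<mu>\<close> is the largest of the means of the arms.\<close>

definition regret ::
  "'a measure \<Rightarrow> ('a \<Rightarrow> 'u) \<Rightarrow> (nat \<Rightarrow> nat \<Rightarrow> 'a \<Rightarrow> real) \<Rightarrow> real \<Rightarrow>
     (nat \<Rightarrow> 'u \<Rightarrow> history \<Rightarrow> nat) \<Rightarrow> nat \<Rightarrow> real" where
  "regret M U X \<mu> \<pi> T = real T * \<mu> - (\<integral>\<omega>. (\<Sum>t=1..T. policy_reward \<pi> U X t \<omega>) \<partial>M)"

section \<open>Deterministic sequencing of exploration and exploitation\<close>

definition cyclic_index :: "nat \<Rightarrow> nat \<Rightarrow> nat" where
  "cyclic_index k l = (k - 1) mod l + 1"

definition observations :: "nat set \<Rightarrow> history \<Rightarrow> nat \<Rightarrow> nat set" where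
  "observations E h n = {s \<in> E. fst (h s) = n}"

definition sample_mean :: "nat set \<Rightarrow> history \<Rightarrow> nat \<Rightarrow> real" where
  "sample_mean E h n =
     (\<Sum>s\<in>observations E h n. snd (h s)) / real (card (observations E h n))"

text \<open>\<open>A t\<close> is the set of exploration times up to \<open>t\<close>. In exploitation, \<open>m\<close> is the vector of
  estimates: its entry is the sample mean for each arm observed during exploration and
  unconstrained for the others.\<close>

definition is_dsee ::
  "nat \<Rightarrow> (nat \<Rightarrow> nat set) \<Rightarrow> 'u measure \<Rightarrow> (nat \<Rightarrow> 'u \<Rightarrow> history \<Rightarrow> nat) \<Rightarrow> bool" where
  "is_dsee N A S \<pi> \<longleftrightarrow> is_policy N S \<pi> \<and>
     (\<forall>t\<ge>1. \<forall>u\<in>space S. \<forall>h\<in>space (history_space t).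
        if t \<in> A t then \<pi> t u h = cyclic_index (card (A t)) N
        else (\<exists>m. (\<forall>n\<in>{1..N}. observations (A (t - 1)) h n \<noteq> {} \<longrightarrow>
                               m n = sample_mean (A (t - 1)) h n) \<and>
                  (\<forall>n\<in>{1..N}. m n \<le> (m (\<pi> t u h) :: real))))"

definition explore_exponent :: "real \<Rightarrow> real" where
  "explore_exponent p = (if p \<le> 2 then 1 / p else 1 / (1 + p / 2))"

fun explore :: "real \<Rightarrow> real \<Rightarrow> nat \<Rightarrow> nat set" where
  "explore p v 0 = {}"
| "explore p v (Suc t) =
     (if Suc t > 1 \<and> real (card (explore p v t)) < v * real (Suc t) powr explore_exponent p
      then insert (Suc t) (explore p v t) else explore p v t)"

end

theory Submission
  imports Defs
begin

text \<open>
  Exploration costs at most a constant times the number of exploration times, which is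
  \<open>O(T powr \<alpha>)\<close> for \<open>\<alpha> = explore_exponent p\<close>. At an exploitation time \<open>t > 1\<close> there have been
  at least \<open>v * t powr \<alpha>\<close> exploration times, distributed evenly over the arms at deterministic times,
  so the estimates are means of a deterministic number \<open>m\<close>, of order \<open>t powr \<alpha>\<close>, of independent
  rewards. The inequalities
  \<open>\<bar>a + b\<bar> powr p \<le> \<bar>a\<bar> powr p + p * (sgn a * \<bar>a\<bar> powr (p - 1)) * b + remainder\<close> yield, by induction
  over the summands, that the centred sum has \<open>p\<close>th moment \<open>O(m powr max 1 (p / 2))\<close>. By Markov's
  inequality a suboptimal arm is then played with probability \<open>O(t powr (\<alpha> - 1))\<close>, and these
  probabilities sum to \<open>O(T powr \<alpha>)\<close>.
\<close>

section \<open>Power inequalities\<close>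

text \<open>With only \<open>p\<close> moments, deviation probabilities decay polynomially in the
  sample size \<open>m\<close>, at rate \<open>m powr (e - p)\<close> with
  \<open>e = moment_exponent p\<close>. The exponent \<alpha> solves
  \<open>\<alpha> * (p - e) = 1 - \<alpha>\<close>, which gives exploration cost and exploitation
  loss the same order; the two cases of the theorem are the two forms of \<open>e\<close>. The
  linear term of the power inequality is kept exact because its expectation vanishes. Bounding it in
  absolute value would allow growth of order \<open>m powr p\<close>, and then Markov's inequality
  yields no decay. Regret involves the arm actually played, which is random and may depend on the
  seed. To replace rewards by means, the current reward is shown independent of the sigma-algebra of
  the seed and all earlier rewards, in which the choice of arm is measurable. Constants are explicit
  in \<open>f\<close>, \<open>N\<close>, \<open>p\<close>, \<open>v\<close>, since one bound must
  serve all probability spaces, seeds and policies.\<close>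

lemma exp_le_quadratic:
  fixes y :: real
  assumes "\<bar>y\<bar> \<le> 1"
  shows "exp y \<le> 1 + y + y\<^sup>2"
proof (cases "y \<ge> 0")
  case True
  then show ?thesis using assms exp_bound[of y] by simp
next
  case False
  \<comment> \<open>For negative \<open>y\<close> the claim is
    \<open>exp (- z) \<le> 1 - z + z * z\<close>. It suffices that the right side times the
    quadratic Taylor polynomial of \<open>exp z\<close> is at least \<open>1\<close>; in that
    product the linear term cancels and the remaining coefficients are nonnegative.\<close>
  define z where "z = - y"
  have z: "z > 0" using False by (simp add: z_def)
  have ge: "1 + z + z\<^sup>2 / 2 \<le> exp z" using exp_lower_Taylor_quadratic[of z] z by simp
  have pos: "0 \<le> 1 - z + z\<^sup>2" using sum_power2_ge_zero[of "z - 1/2" 0] by (simp add: power2_eq_square algebra_simps)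
  have "1 \<le> 1 + z\<^sup>2 / 2 + z^3 / 2 + z^4 / 2" using z by simp
  also have "\<dots> = (1 - z + z\<^sup>2) * (1 + z + z\<^sup>2 / 2)"
    by (simp add: field_simps power2_eq_square power3_eq_cube power4_eq_xxxx)
  also have "\<dots> \<le> (1 - z + z\<^sup>2) * exp z" by (rule mult_left_mono[OF ge pos])
  finally have "1 \<le> (1 - z + z\<^sup>2) * exp z" .
  then have "exp (- z) * 1 \<le> exp (- z) * ((1 - z + z\<^sup>2) * exp z)" by (intro mult_left_mono) auto
  also have "\<dots> = 1 - z + z\<^sup>2" by (simp add: exp_minus field_simps)
  finally show ?thesis by (simp add: z_def)
qed

text \<open>One constant for both regimes of \<open>one_plus_powr_le\<close>: the square of
  \<open>p\<close> comes from the square of \<open>p * x\<close> for small \<open>x\<close>; for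
  large \<open>x\<close>, \<open>(p + 1) powr p\<close> bounds the left side and
  \<open>p powr p\<close> compensates a negative linear term.\<close>

definition powr_const :: "real \<Rightarrow> real" where
  "powr_const p = (p + 1) powr p + p powr p + p\<^sup>2"

lemma powr_const_pos: "p > 1 \<Longrightarrow> powr_const p > 0"
  by (simp add: powr_const_def add_nonneg_pos)

text \<open>The threshold \<open>1 / p\<close> is where \<open>p * \<bar>x\<bar> = 1\<close>. Below
  it, \<open>ln (1 + x) \<le> x\<close> and \<open>exp_le_quadratic\<close> at \<open>p * x\<close>
  apply; above it, both \<open>\<bar>1 + x\<bar>\<close> and the linear term are controlled by
  multiples of \<open>\<bar>x\<bar>\<close> that exceed \<open>1\<close>.\<close>

lemma one_plus_powr_le:
  fixes p x :: real
  assumes p: "p > 1"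
  shows "\<bar>x\<bar> \<le> 1 / p \<Longrightarrow> \<bar>1 + x\<bar> powr p \<le> 1 + p * x + powr_const p * x\<^sup>2"
    and "\<bar>x\<bar> > 1 / p \<Longrightarrow> \<bar>1 + x\<bar> powr p \<le> 1 + p * x + powr_const p * \<bar>x\<bar> powr p"
proof -
  assume x: "\<bar>x\<bar> \<le> 1 / p"
  have "1 / p < 1" using p by simp
  then have pos: "1 + x > 0" using x by linarith
  have px: "\<bar>p * x\<bar> \<le> 1" using x p by (simp add: abs_mult field_simps)
  have "\<bar>1 + x\<bar> powr p = exp (p * ln (1 + x))" using pos by (simp add: powr_def)
  also have "\<dots> \<le> exp (p * x)" using pos p ln_add_one_self_le_self2[of x] by simp
  also have "\<dots> \<le> 1 + p * x + (p * x)\<^sup>2" by (rule exp_le_quadratic[OF px])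
  also have "\<dots> \<le> 1 + p * x + powr_const p * x\<^sup>2"
    by (simp add: powr_const_def power_mult_distrib mult_right_mono)
  finally show "\<bar>1 + x\<bar> powr p \<le> 1 + p * x + powr_const p * x\<^sup>2" .
next
  assume x: "\<bar>x\<bar> > 1 / p"
  have x1: "1 \<le> p * \<bar>x\<bar>" using x p by (simp add: field_simps)
  have x0: "\<bar>x\<bar> > 0" using x p by (meson divide_pos_pos less_trans zero_less_one)
  have "\<bar>1 + x\<bar> \<le> (p + 1) * \<bar>x\<bar>" using x1 by (simp add: algebra_simps)
  then have "\<bar>1 + x\<bar> powr p \<le> ((p + 1) * \<bar>x\<bar>) powr p" using p by (intro powr_mono2) auto
  also have "\<dots> = (p + 1) powr p * \<bar>x\<bar> powr p" using p by (simp add: powr_mult)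
  finally have 1: "\<bar>1 + x\<bar> powr p \<le> (p + 1) powr p * \<bar>x\<bar> powr p" .
  have "p * \<bar>x\<bar> = (p * \<bar>x\<bar>) powr 1" using x0 p by simp
  also have "\<dots> \<le> (p * \<bar>x\<bar>) powr p" using x1 p by (intro powr_mono) auto
  also have "\<dots> = p powr p * \<bar>x\<bar> powr p" using p by (simp add: powr_mult)
  finally have 2: "p * \<bar>x\<bar> \<le> p powr p * \<bar>x\<bar> powr p" .
  have "- (p * x) \<le> p * \<bar>x\<bar>" using p by (simp add: abs_if)
  moreover have "0 \<le> p\<^sup>2 * \<bar>x\<bar> powr p" by simp
  moreover have "powr_const p * \<bar>x\<bar> powr p =
      (p + 1) powr p * \<bar>x\<bar> powr p + p powr p * \<bar>x\<bar> powr p + p\<^sup>2 * \<bar>x\<bar> powr p"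
    by (simp add: powr_const_def distrib_right)
  ultimately show "\<bar>1 + x\<bar> powr p \<le> 1 + p * x + powr_const p * \<bar>x\<bar> powr p"
    using 1 2 by linarith
qed

text \<open>Homogeneity reduces this to \<open>one_plus_powr_le\<close> with
  \<open>x = b / a\<close>. The coefficient of \<open>b\<close> is the derivative of
  \<open>\<bar>a\<bar> powr p\<close>.\<close>

lemma powr_add_le:
  fixes a b p :: real
  assumes p: "p > 1"
  shows "\<bar>a + b\<bar> powr p \<le> \<bar>a\<bar> powr p + p * (sgn a * \<bar>a\<bar> powr (p - 1)) * b +
    powr_const p * (if p * \<bar>b\<bar> \<le> \<bar>a\<bar> then \<bar>a\<bar> powr (p - 2) * b\<^sup>2 else \<bar>b\<bar> powr p)"
proof (cases "a = 0")
  case True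
  have "p \<ge> 1" using p by simp
  \<comment> \<open>There is no quotient \<open>b / a\<close> here; the claim reduces to
    \<open>powr_const p\<close> being at least \<open>1\<close>.\<close>
  then have "1 \<le> (p + 1) powr p" using p by (intro ge_one_powr_ge_zero) auto
  then have "1 \<le> powr_const p" unfolding powr_const_def by (simp add: add_increasing2)
  then have "1 * \<bar>b\<bar> powr p \<le> powr_const p * \<bar>b\<bar> powr p" by (intro mult_right_mono) auto
  then show ?thesis using True p by (auto simp: mult_le_0_iff)
next
  case False
  define x where "x = b / a"
  have b: "b = a * x" using False by (simp add: x_def)
  have a: "\<bar>a\<bar> > 0" using False by simp
  have split: "\<bar>a + b\<bar> powr p = \<bar>a\<bar> powr p * \<bar>1 + x\<bar> powr p"
    by (simp add: b powr_mult[symmetric] abs_mult[symmetric] algebra_simps)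
  have "\<bar>a\<bar> powr p = \<bar>a\<bar> powr (p - 1) * \<bar>a\<bar>" using a by (simp add: powr_diff)
  then have lin: "\<bar>a\<bar> powr p * (p * x) = p * (sgn a * \<bar>a\<bar> powr (p - 1)) * b"
    using a by (simp add: b abs_sgn[of a] algebra_simps)
  have "\<bar>a\<bar> powr p = \<bar>a\<bar> powr (p - 2) * a\<^sup>2" using a by (simp add: powr_diff)
  then have quad: "\<bar>a\<bar> powr p * x\<^sup>2 = \<bar>a\<bar> powr (p - 2) * b\<^sup>2" by (simp add: b power_mult_distrib)
  have pow: "\<bar>a\<bar> powr p * \<bar>x\<bar> powr p = \<bar>b\<bar> powr p" by (simp add: b powr_mult abs_mult)
  show ?thesis
  proof (cases "p * \<bar>b\<bar> \<le> \<bar>a\<bar>")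
    case True
    then have "\<bar>x\<bar> \<le> 1 / p" using p a by (simp add: b abs_mult field_simps)
    then have "\<bar>a\<bar> powr p * \<bar>1 + x\<bar> powr p \<le> \<bar>a\<bar> powr p * (1 + p * x + powr_const p * x\<^sup>2)"
      using one_plus_powr_le(1)[OF p] by (intro mult_left_mono) auto
    also have "\<dots> = \<bar>a\<bar> powr p + \<bar>a\<bar> powr p * (p * x) + powr_const p * (\<bar>a\<bar> powr p * x\<^sup>2)"
      by (simp add: algebra_simps)
    finally show ?thesis using True by (simp only: split lin quad if_True)
  next
    case False
    then have "\<bar>x\<bar> > 1 / p" using p a by (simp add: b abs_mult field_simps)
    then have "\<bar>a\<bar> powr p * \<bar>1 + x\<bar> powr p \<le> \<bar>a\<bar> powr p * (1 + p * x + powr_const p * \<bar>x\<bar> powr p)"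
      using one_plus_powr_le(2)[OF p] by (intro mult_left_mono) auto
    also have "\<dots> = \<bar>a\<bar> powr p + \<bar>a\<bar> powr p * (p * x) + powr_const p * (\<bar>a\<bar> powr p * \<bar>x\<bar> powr p)"
      by (simp add: algebra_simps)
    finally show ?thesis using False by (simp only: split lin pow if_False)
  qed
qed

text \<open>The quadratic remainder occurs only when
  \<open>\<bar>b\<bar> \<le> \<bar>a\<bar>\<close>; since \<open>p - 2 \<le> 0\<close>, replacing
  \<open>\<bar>a\<bar>\<close> by \<open>\<bar>b\<bar>\<close> in its power can only increase it.
  This is the pointwise form of a von Bahr-Esseen inequality.\<close>

lemma powr_add_le_small:
  fixes a b p :: real
  assumes p: "1 < p" "p \<le> 2"
  shows "\<bar>a + b\<bar> powr p \<le>
    \<bar>a\<bar> powr p + p * (sgn a * \<bar>a\<bar> powr (p - 1)) * b + powr_const p * \<bar>b\<bar> powr p"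
proof -
  have "\<bar>a\<bar> powr (p - 2) * b\<^sup>2 \<le> \<bar>b\<bar> powr p" if le: "p * \<bar>b\<bar> \<le> \<bar>a\<bar>"
  proof (cases "b = 0")
    case False
    have "1 * \<bar>b\<bar> \<le> p * \<bar>b\<bar>" using p by (intro mult_right_mono) auto
    then have "\<bar>b\<bar> \<le> \<bar>a\<bar>" using le by simp
    then have "\<bar>a\<bar> powr (p - 2) \<le> \<bar>b\<bar> powr (p - 2)" using False p by (intro powr_mono2') auto
    then have "\<bar>a\<bar> powr (p - 2) * b\<^sup>2 \<le> \<bar>b\<bar> powr (p - 2) * b\<^sup>2" by (intro mult_right_mono) auto
    also have "\<dots> = \<bar>b\<bar> powr p" using False by (simp add: powr_diff)
    finally show ?thesis .
  qed simp
  then have "powr_const p * (if p * \<bar>b\<bar> \<le> \<bar>a\<bar> then \<bar>a\<bar> powr (p - 2) * b\<^sup>2 else \<bar>b\<bar> powr p)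
      \<le> powr_const p * \<bar>b\<bar> powr p"
    using powr_const_pos[of p] p by (intro mult_left_mono) auto
  then show ?thesis using powr_add_le[OF p(1), of a b] by linarith
qed

lemma powr_add_le_large:
  fixes a b p \<eta> k :: real
  assumes p: "2 < p" and \<eta>: "\<eta> > 0" and k: "k > 0"
  shows "\<bar>a + b\<bar> powr p \<le> \<bar>a\<bar> powr p + p * (sgn a * \<bar>a\<bar> powr (p - 1)) * b +
    powr_const p * ((\<eta> * \<bar>a\<bar> powr p / k + (k / \<eta>) powr (p / 2 - 1)) * b\<^sup>2 + \<bar>b\<bar> powr p)"
proof -
  \<comment> \<open>This replaces Lyapunov's inequality, which would bound the moment of order \<open>p - 2\<close>
    by the moment of order \<open>p\<close>.\<close>
  have "\<bar>a\<bar> powr (p - 2) \<le> \<eta> * \<bar>a\<bar> powr p / k + (k / \<eta>) powr (p / 2 - 1)"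
  \<comment> \<open>At the threshold the factor \<open>\<eta> * a * a / k\<close> equals
    \<open>1\<close>. Above it, multiplying by this factor raises the exponent from
    \<open>p - 2\<close> to \<open>p\<close>; below it, monotonicity of the power
    \<open>p / 2 - 1\<close> gives the second summand.\<close>
  proof (cases "k / \<eta> \<le> a\<^sup>2")
    case True
    have a: "a \<noteq> 0"
    proof
      assume "a = 0"
      with True have "k / \<eta> \<le> 0" by simp
      then show False using divide_pos_pos[OF k \<eta>] by linarith
    qed
    have "1 \<le> \<eta> * a\<^sup>2 / k" using True \<eta> k by (simp add: field_simps)
    then have "\<bar>a\<bar> powr (p - 2) * 1 \<le> \<bar>a\<bar> powr (p - 2) * (\<eta> * a\<^sup>2 / k)" by (intro mult_left_mono) auto
    also have "\<dots> = \<eta> * \<bar>a\<bar> powr p / k" using a by (simp add: powr_diff)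
    also have "\<dots> \<le> \<eta> * \<bar>a\<bar> powr p / k + (k / \<eta>) powr (p / 2 - 1)" by simp
    finally show ?thesis by simp
  next
    case False
    have "\<bar>a\<bar> powr (p - 2) = (\<bar>a\<bar> powr 2) powr (p / 2 - 1)" 
      unfolding powr_powr by (simp add: algebra_simps)
    also have "\<dots> = (a\<^sup>2) powr (p / 2 - 1)" by (cases "a = 0") auto
    also have "\<dots> \<le> (k / \<eta>) powr (p / 2 - 1)" using False p by (intro powr_mono2) auto
    also have "\<dots> \<le> \<eta> * \<bar>a\<bar> powr p / k + (k / \<eta>) powr (p / 2 - 1)" using \<eta> k by simp
    finally show ?thesis .
  qed
  then have le: "\<bar>a\<bar> powr (p - 2) * b\<^sup>2 \<le> (\<eta> * \<bar>a\<bar> powr p / k + (k / \<eta>) powr (p / 2 - 1)) * b\<^sup>2"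
    by (intro mult_right_mono) auto
  moreover have "0 \<le> (\<eta> * \<bar>a\<bar> powr p / k + (k / \<eta>) powr (p / 2 - 1)) * b\<^sup>2" using \<eta> k by simp
  ultimately have "(if p * \<bar>b\<bar> \<le> \<bar>a\<bar> then \<bar>a\<bar> powr (p - 2) * b\<^sup>2 else \<bar>b\<bar> powr p)
      \<le> (\<eta> * \<bar>a\<bar> powr p / k + (k / \<eta>) powr (p / 2 - 1)) * b\<^sup>2 + \<bar>b\<bar> powr p"
    by (auto intro: add_increasing2)
  then have "powr_const p * (if p * \<bar>b\<bar> \<le> \<bar>a\<bar> then \<bar>a\<bar> powr (p - 2) * b\<^sup>2 else \<bar>b\<bar> powr p)
      \<le> powr_const p * ((\<eta> * \<bar>a\<bar> powr p / k + (k / \<eta>) powr (p / 2 - 1)) * b\<^sup>2 + \<bar>b\<bar> powr p)"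
    using powr_const_pos[of p] p by (intro mult_left_mono) auto
  moreover have "p > 1" using p by simp
  ultimately show ?thesis using powr_add_le[of p a b] by linarith
qed

section \<open>Tangent-line bounds for powers and sums of powers\<close>

lemma powr_le_affine:
  fixes y \<alpha> :: real
  assumes "y \<ge> 0" "0 < \<alpha>" "\<alpha> \<le> 1"
  shows "y powr \<alpha> \<le> \<alpha> * y + (1 - \<alpha>)"
  using Youngs_inequality_0[of \<alpha> "1 - \<alpha>" y 1] assms by (cases "y = 0") auto

text \<open>Bernoulli's inequality, read off from the tangent-line bound for the concave power
  \<open>1 / e\<close> at the point \<open>(1 + x) powr e\<close>.\<close>

lemma one_plus_powr_ge:
  fixes x e :: real
  assumes "x \<ge> 0" "e \<ge> 1"
  shows "1 + e * x \<le> (1 + x) powr e"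
proof -
  have "1 + x = ((1 + x) powr e) powr (1 / e)" using assms by (simp add: powr_powr)
  also have "\<dots> \<le> (1 / e) * (1 + x) powr e + (1 - 1 / e)" using assms by (intro powr_le_affine) auto
  finally have "e * (1 + x) \<le> e * ((1 / e) * (1 + x) powr e + (1 - 1 / e))"
    using assms by (intro mult_left_mono) auto
  then show ?thesis using assms by (simp add: algebra_simps)
qed

text \<open>The sum telescopes: the tangent-line bound at \<open>1 - 1 / t\<close> says that
  \<open>\<alpha> * t powr (\<alpha> - 1)\<close> is at most the increment of the power \<alpha>
  from \<open>t - 1\<close> to \<open>t\<close>.\<close>

lemma sum_powr_le:
  fixes \<alpha> :: real
  assumes "0 < \<alpha>" "\<alpha> \<le> 1"
  shows "(\<Sum>t=1..T. real t powr (\<alpha> - 1)) \<le> real T powr \<alpha> / \<alpha>"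
proof (induction T)
  case (Suc T)
  define t where "t = real (Suc T)"
  have t: "t > 0" "real T = t * (1 - 1 / t)" "1 - 1 / t \<ge> 0" by (simp_all add: t_def field_simps)
  have "real T powr \<alpha> = t powr \<alpha> * (1 - 1 / t) powr \<alpha>"
    unfolding t(2) using t by (simp add: powr_mult)
  also have "\<dots> \<le> t powr \<alpha> * (\<alpha> * (1 - 1 / t) + (1 - \<alpha>))"
    using assms t by (intro mult_left_mono powr_le_affine) auto
  also have "\<dots> = t powr \<alpha> - \<alpha> * t powr (\<alpha> - 1)" using t by (simp add: powr_diff field_simps)
  finally have "(real T powr \<alpha> + \<alpha> * t powr (\<alpha> - 1)) / \<alpha> \<le> t powr \<alpha> / \<alpha>"
    using assms by (intro divide_right_mono) auto
  then have "t powr (\<alpha> - 1) + real T powr \<alpha> / \<alpha> \<le> t powr \<alpha> / \<alpha>"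
    using assms by (simp add: add_divide_distrib)
  then show ?case using Suc by (simp add: t_def)
qed simp

lemma powr_le_one_plus_powr:
  fixes y p q :: real
  assumes "0 \<le> q" "q \<le> p"
  shows "\<bar>y\<bar> powr q \<le> 1 + \<bar>y\<bar> powr p"
proof (cases "\<bar>y\<bar> \<le> 1")
  case True
  then have "\<bar>y\<bar> powr q \<le> 1" using assms powr_mono2[of q "\<bar>y\<bar>" 1] by simp
  then show ?thesis by (simp add: add_increasing2)
next
  case False
  then have "\<bar>y\<bar> powr q \<le> \<bar>y\<bar> powr p" using assms by (intro powr_mono) auto
  then show ?thesis by simp
qed

section \<open>Moments of sums of independent centred variables\<close>

text \<open>For \<open>p \<le> 2\<close> moments grow linearly in the number of summands; beyond
  that the central limit scale \<open>p / 2\<close> takes over.\<close>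

definition moment_exponent :: "real \<Rightarrow> real" where
  "moment_exponent p = max 1 (p / 2)"

text \<open>The base of the power is the \<open>\<eta>\<close> with \<open>powr_const p * \<eta> * (1 + B) = p / 4\<close>, half of the growth rate \<open>p / 2\<close> of \<open>k powr (p / 2)\<close>;
  the other half absorbs the lower-order terms.\<close>

definition moment_aux :: "real \<Rightarrow> real \<Rightarrow> real" where
  "moment_aux p B = powr_const p *
     ((p / (4 * powr_const p * (1 + B))) powr (1 - p / 2) * (1 + B) + B)"

text \<open>For \<open>p > 2\<close> the summand \<open>B\<close> covers a single variable, and the
  other one makes \<open>moment_aux p B\<close> at most \<open>p / 4\<close> times the whole
  constant, as the induction in \<open>moment_sum\<close> requires.\<close>

definition moment_const :: "real \<Rightarrow> real \<Rightarrow> real" where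
  "moment_const p B = (if p \<le> 2 then powr_const p * B else B + 4 * moment_aux p B / p)"

lemma moment_const_nonneg: "p > 1 \<Longrightarrow> B \<ge> 0 \<Longrightarrow> moment_const p B \<ge> 0"
  using powr_const_pos[of p] by (simp add: moment_const_def moment_aux_def)

context prob_space
begin

lemma integrable_powr_mono:
  fixes Y :: "'a \<Rightarrow> real"
  assumes "0 \<le> q" "q \<le> p" and [measurable]: "Y \<in> borel_measurable M"
    and "integrable M (\<lambda>\<omega>. \<bar>Y \<omega>\<bar> powr p)"
  shows "integrable M (\<lambda>\<omega>. \<bar>Y \<omega>\<bar> powr q)"
proof (rule Bochner_Integration.integrable_bound)
  show "integrable M (\<lambda>\<omega>. 1 + \<bar>Y \<omega>\<bar> powr p)" using assms by simp
qed (use powr_le_one_plus_powr[OF assms(1,2)] in auto)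

lemma integrable_of_powr:
  fixes Y :: "'a \<Rightarrow> real"
  assumes "1 \<le> p" and [measurable]: "Y \<in> borel_measurable M"
    and "integrable M (\<lambda>\<omega>. \<bar>Y \<omega>\<bar> powr p)"
  shows "integrable M Y"
proof -
  have "integrable M (\<lambda>\<omega>. \<bar>Y \<omega>\<bar> powr 1)" by (rule integrable_powr_mono[of 1 p]) (use assms in auto)
  then show ?thesis by (simp add: integrable_abs_iff)
qed

lemma integrable_powr_add:
  fixes S Y :: "'a \<Rightarrow> real"
  assumes p: "0 \<le> p" and [measurable]: "S \<in> borel_measurable M" "Y \<in> borel_measurable M"
    and "integrable M (\<lambda>\<omega>. \<bar>S \<omega>\<bar> powr p)" "integrable M (\<lambda>\<omega>. \<bar>Y \<omega>\<bar> powr p)"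
  shows "integrable M (\<lambda>\<omega>. \<bar>S \<omega> + Y \<omega>\<bar> powr p)"
proof (rule Bochner_Integration.integrable_bound)
  show "integrable M (\<lambda>\<omega>. 2 powr p * (\<bar>S \<omega>\<bar> powr p + \<bar>Y \<omega>\<bar> powr p))" using assms by simp
  have "\<bar>a + b\<bar> powr p \<le> 2 powr p * (\<bar>a\<bar> powr p + \<bar>b\<bar> powr p)" for a b :: real
  proof -
    have "\<bar>a + b\<bar> powr p \<le> (2 * max \<bar>a\<bar> \<bar>b\<bar>) powr p" using p by (intro powr_mono2) auto
    also have "\<dots> = 2 powr p * max \<bar>a\<bar> \<bar>b\<bar> powr p" by (simp add: powr_mult)
    also have "\<dots> \<le> 2 powr p * (\<bar>a\<bar> powr p + \<bar>b\<bar> powr p)"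
      by (intro mult_left_mono) (auto simp: max_def)
    finally show ?thesis .
  qed
  then show "AE \<omega> in M. norm (\<bar>S \<omega> + Y \<omega>\<bar> powr p) \<le> norm (2 powr p * (\<bar>S \<omega>\<bar> powr p + \<bar>Y \<omega>\<bar> powr p))"
    by (simp add: abs_mult)
qed simp

text \<open>Independence factors the expectation, and the factor \<open>expectation Y\<close> is
  zero. The other factor is integrable because a finite moment of order \<open>p\<close> gives one
  of order \<open>p - 1\<close>.\<close>

lemma cross_term:
  fixes S Y :: "'a \<Rightarrow> real"
  assumes p: "1 \<le> p" and indep: "indep_var borel Y borel S"
    and S: "integrable M (\<lambda>\<omega>. \<bar>S \<omega>\<bar> powr p)" and Y: "integrable M Y" "expectation Y = 0"
  shows "integrable M (\<lambda>\<omega>. sgn (S \<omega>) * \<bar>S \<omega>\<bar> powr (p - 1) * Y \<omega>)"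
    and "expectation (\<lambda>\<omega>. sgn (S \<omega>) * \<bar>S \<omega>\<bar> powr (p - 1) * Y \<omega>) = 0"
proof -
  have [measurable]: "S \<in> borel_measurable M" using indep by (rule indep_var_rv2)
  let ?g = "\<lambda>s::real. sgn s * \<bar>s\<bar> powr (p - 1)"
  have "indep_var borel ((\<lambda>y. y) \<circ> Y) borel (?g \<circ> S)" by (rule indep_var_compose[OF indep]) auto
  then have i: "indep_var borel Y borel (\<lambda>\<omega>. ?g (S \<omega>))" by (simp add: comp_def)
  have "integrable M (\<lambda>\<omega>. \<bar>S \<omega>\<bar> powr (p - 1))" by (rule integrable_powr_mono[of _ p]) (use p S in auto)
  then have gi: "integrable M (\<lambda>\<omega>. ?g (S \<omega>))"
    by (rule Bochner_Integration.integrable_bound) (auto simp: abs_mult abs_sgn_eq)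
  show "integrable M (\<lambda>\<omega>. ?g (S \<omega>) * Y \<omega>)"
    using indep_var_integrable[OF i Y(1) gi] by (simp add: mult.commute)
  show "expectation (\<lambda>\<omega>. ?g (S \<omega>) * Y \<omega>) = 0"
    using indep_var_lebesgue_integral[OF i Y(1) gi] Y(2) by (simp add: mult.commute)
qed

lemma moment_add_small:
  fixes S Y :: "'a \<Rightarrow> real"
  assumes p: "1 < p" "p \<le> 2" and indep: "indep_var borel Y borel S"
    and S: "integrable M (\<lambda>\<omega>. \<bar>S \<omega>\<bar> powr p)" and Y: "integrable M (\<lambda>\<omega>. \<bar>Y \<omega>\<bar> powr p)"
    and Y0: "expectation Y = 0"
  shows "expectation (\<lambda>\<omega>. \<bar>S \<omega> + Y \<omega>\<bar> powr p) \<le>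
    expectation (\<lambda>\<omega>. \<bar>S \<omega>\<bar> powr p) + powr_const p * expectation (\<lambda>\<omega>. \<bar>Y \<omega>\<bar> powr p)"
proof -
  have [measurable]: "S \<in> borel_measurable M" "Y \<in> borel_measurable M"
    using indep_var_rv1[OF indep] indep_var_rv2[OF indep] by auto
  have Yi: "integrable M Y" by (rule integrable_of_powr[of p]) (use p Y in auto)
  have p1: "1 \<le> p" using p by simp
  note c = cross_term[OF p1 indep S Yi Y0]
  have "expectation (\<lambda>\<omega>. \<bar>S \<omega> + Y \<omega>\<bar> powr p) \<le>
    expectation (\<lambda>\<omega>. \<bar>S \<omega>\<bar> powr p + p * (sgn (S \<omega>) * \<bar>S \<omega>\<bar> powr (p - 1) * Y \<omega>) +
      powr_const p * \<bar>Y \<omega>\<bar> powr p)"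
  proof (rule integral_mono)
    show "integrable M (\<lambda>\<omega>. \<bar>S \<omega> + Y \<omega>\<bar> powr p)" by (rule integrable_powr_add) (use S Y p in auto)
  qed (use S Y c powr_add_le_small[OF p] in \<open>simp_all add: mult.assoc\<close>)
  also have "\<dots> = expectation (\<lambda>\<omega>. \<bar>S \<omega>\<bar> powr p) + powr_const p * expectation (\<lambda>\<omega>. \<bar>Y \<omega>\<bar> powr p)"
    using S Y c by simp
  finally show ?thesis .
qed

text \<open>In \<open>powr_add_le_large\<close> the square of \<open>Y\<close> multiplies a power of
  \<open>S\<close>, so independence factors that term as well; the second moment is at most
  \<open>1 + B\<close> because \<open>y * y \<le> 1 + \<bar>y\<bar> powr p\<close>. Later
  \<open>k\<close> is the number of summands in \<open>S\<close>, and \<eta> keeps the relative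
  growth per step small.\<close>

lemma moment_add_large:
  fixes S Y :: "'a \<Rightarrow> real"
  assumes p: "2 < p" and \<eta>: "\<eta> > 0" and k: "k > 0" and indep: "indep_var borel Y borel S"
    and S: "integrable M (\<lambda>\<omega>. \<bar>S \<omega>\<bar> powr p)" and Y: "integrable M (\<lambda>\<omega>. \<bar>Y \<omega>\<bar> powr p)"
    and Y0: "expectation Y = 0" and B: "expectation (\<lambda>\<omega>. \<bar>Y \<omega>\<bar> powr p) \<le> B"
  shows "expectation (\<lambda>\<omega>. \<bar>S \<omega> + Y \<omega>\<bar> powr p) \<le>
    expectation (\<lambda>\<omega>. \<bar>S \<omega>\<bar> powr p) + powr_const p *
      ((\<eta> * expectation (\<lambda>\<omega>. \<bar>S \<omega>\<bar> powr p) / k + (k / \<eta>) powr (p / 2 - 1)) * (1 + B) + B)"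
proof -
  have [measurable]: "S \<in> borel_measurable M" "Y \<in> borel_measurable M"
    using indep_var_rv1[OF indep] indep_var_rv2[OF indep] by auto
  have Yi: "integrable M Y" by (rule integrable_of_powr[of p]) (use p Y in auto)
  have p1: "1 \<le> p" using p by simp
  note c = cross_term[OF p1 indep S Yi Y0]
  have sq: "\<bar>y\<bar> powr 2 = y\<^sup>2" for y :: real by (cases "y = 0") auto
  have "integrable M (\<lambda>\<omega>. \<bar>Y \<omega>\<bar> powr 2)" by (rule integrable_powr_mono[of 2 p]) (use p Y in auto)
  then have Y2: "integrable M (\<lambda>\<omega>. (Y \<omega>)\<^sup>2)" by (simp add: sq)
  have "expectation (\<lambda>\<omega>. (Y \<omega>)\<^sup>2) \<le> expectation (\<lambda>\<omega>. 1 + \<bar>Y \<omega>\<bar> powr p)"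
    using Y Y2 p powr_le_one_plus_powr[of 2 p] by (intro integral_mono) (auto simp: sq)
  also have "\<dots> \<le> 1 + B" using Y B by (simp add: prob_space)
  finally have V: "expectation (\<lambda>\<omega>. (Y \<omega>)\<^sup>2) \<le> 1 + B" .
  have "indep_var borel ((\<lambda>y. y\<^sup>2) \<circ> Y) borel ((\<lambda>s. \<bar>s\<bar> powr p) \<circ> S)"
    by (rule indep_var_compose[OF indep]) auto
  then have i: "indep_var borel (\<lambda>\<omega>. (Y \<omega>)\<^sup>2) borel (\<lambda>\<omega>. \<bar>S \<omega>\<bar> powr p)" by (simp add: comp_def)
  have SY: "integrable M (\<lambda>\<omega>. \<bar>S \<omega>\<bar> powr p * (Y \<omega>)\<^sup>2)"
      "expectation (\<lambda>\<omega>. \<bar>S \<omega>\<bar> powr p * (Y \<omega>)\<^sup>2) =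
        expectation (\<lambda>\<omega>. \<bar>S \<omega>\<bar> powr p) * expectation (\<lambda>\<omega>. (Y \<omega>)\<^sup>2)"
    using indep_var_integrable[OF i Y2 S] indep_var_lebesgue_integral[OF i Y2 S]
    by (simp_all add: mult.commute)
  define w where "w = (k / \<eta>) powr (p / 2 - 1)"
  have w: "w \<ge> 0" by (simp add: w_def)
  let ?V = "expectation (\<lambda>\<omega>. (Y \<omega>)\<^sup>2)" and ?S = "expectation (\<lambda>\<omega>. \<bar>S \<omega>\<bar> powr p)"
  have "expectation (\<lambda>\<omega>. \<bar>S \<omega> + Y \<omega>\<bar> powr p) \<le>
    expectation (\<lambda>\<omega>. \<bar>S \<omega>\<bar> powr p + p * (sgn (S \<omega>) * \<bar>S \<omega>\<bar> powr (p - 1) * Y \<omega>) +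
      powr_const p * (\<eta> / k * (\<bar>S \<omega>\<bar> powr p * (Y \<omega>)\<^sup>2) + w * (Y \<omega>)\<^sup>2 + \<bar>Y \<omega>\<bar> powr p))"
  proof (rule integral_mono)
    show "integrable M (\<lambda>\<omega>. \<bar>S \<omega> + Y \<omega>\<bar> powr p)" by (rule integrable_powr_add) (use S Y p in auto)
    show "integrable M (\<lambda>\<omega>. \<bar>S \<omega>\<bar> powr p + p * (sgn (S \<omega>) * \<bar>S \<omega>\<bar> powr (p - 1) * Y \<omega>) +
      powr_const p * (\<eta> / k * (\<bar>S \<omega>\<bar> powr p * (Y \<omega>)\<^sup>2) + w * (Y \<omega>)\<^sup>2 + \<bar>Y \<omega>\<bar> powr p))"
      using S Y c SY Y2 by (intro Bochner_Integration.integrable_add integrable_mult_right) auto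
  next
    fix \<omega>
    have "(\<eta> * \<bar>S \<omega>\<bar> powr p / k + w) * (Y \<omega>)\<^sup>2 = \<eta> / k * (\<bar>S \<omega>\<bar> powr p * (Y \<omega>)\<^sup>2) + w * (Y \<omega>)\<^sup>2"
      by (simp add: algebra_simps)
    then show "\<bar>S \<omega> + Y \<omega>\<bar> powr p \<le>
      \<bar>S \<omega>\<bar> powr p + p * (sgn (S \<omega>) * \<bar>S \<omega>\<bar> powr (p - 1) * Y \<omega>) +
      powr_const p * (\<eta> / k * (\<bar>S \<omega>\<bar> powr p * (Y \<omega>)\<^sup>2) + w * (Y \<omega>)\<^sup>2 + \<bar>Y \<omega>\<bar> powr p)"
      using powr_add_le_large[OF p \<eta> k, of "S \<omega>" "Y \<omega>"] by (simp add: w_def mult.assoc)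
  qed
  also have "\<dots> = ?S + powr_const p * (\<eta> / k * (?S * ?V) + w * ?V + expectation (\<lambda>\<omega>. \<bar>Y \<omega>\<bar> powr p))"
    using S Y Y2 c SY by simp
  also have "\<dots> = ?S + powr_const p * ((\<eta> * ?S / k + w) * ?V + expectation (\<lambda>\<omega>. \<bar>Y \<omega>\<bar> powr p))"
    by (simp add: algebra_simps)
  also have "\<dots> \<le> ?S + powr_const p * ((\<eta> * ?S / k + w) * (1 + B) + B)"
    using V B w \<eta> k p powr_const_pos[of p]
    by (intro add_left_mono mult_left_mono add_mono) auto
  finally show ?thesis by (simp add: w_def)
qed

text \<open>For \<open>p \<le> 2\<close> each summand adds at most \<open>powr_const p * B\<close>.
  For \<open>p > 2\<close> the step after \<open>k\<close> summands adds at most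
  \<open>p / (4 * k)\<close> times the current bound and
  \<open>moment_aux p B * k powr (p / 2 - 1)\<close>; a large enough multiple of
  \<open>k powr (p / 2)\<close> grows fast enough to absorb both.\<close>

lemma moment_sum:
  fixes Y :: "'i \<Rightarrow> 'a \<Rightarrow> real"
  assumes p: "1 < p" and B0: "B \<ge> 0" and "finite I" and "indep_vars (\<lambda>_. borel) Y I"
    and "\<And>i. i \<in> I \<Longrightarrow> integrable M (\<lambda>\<omega>. \<bar>Y i \<omega>\<bar> powr p)"
    and "\<And>i. i \<in> I \<Longrightarrow> expectation (Y i) = 0"
    and "\<And>i. i \<in> I \<Longrightarrow> expectation (\<lambda>\<omega>. \<bar>Y i \<omega>\<bar> powr p) \<le> B"
  shows "integrable M (\<lambda>\<omega>. \<bar>\<Sum>i\<in>I. Y i \<omega>\<bar> powr p) \<and>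
    expectation (\<lambda>\<omega>. \<bar>\<Sum>i\<in>I. Y i \<omega>\<bar> powr p) \<le> moment_const p B * real (card I) powr moment_exponent p"
  using assms(3-)
proof (induction I rule: finite_induct)
  case empty
  then show ?case using p by (simp add: moment_exponent_def)
next
  case (insert i I)
  have iI: "indep_vars (\<lambda>_. borel) Y I" using insert.prems(1) by (rule indep_vars_subset) auto
  have IH: "integrable M (\<lambda>\<omega>. \<bar>\<Sum>i\<in>I. Y i \<omega>\<bar> powr p)"
    "expectation (\<lambda>\<omega>. \<bar>\<Sum>i\<in>I. Y i \<omega>\<bar> powr p) \<le> moment_const p B * real (card I) powr moment_exponent p"
    using insert.IH[OF iI] insert.prems by auto
  have ind: "indep_var borel (Y i) borel (\<lambda>\<omega>. \<Sum>i\<in>I. Y i \<omega>)"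
    using insert by (intro indep_vars_sum) auto
  have Yi: "integrable M (\<lambda>\<omega>. \<bar>Y i \<omega>\<bar> powr p)" "expectation (Y i) = 0"
    "expectation (\<lambda>\<omega>. \<bar>Y i \<omega>\<bar> powr p) \<le> B" using insert.prems by auto
  have [measurable]: "Y i \<in> borel_measurable M" "(\<lambda>\<omega>. \<Sum>i\<in>I. Y i \<omega>) \<in> borel_measurable M"
    using indep_var_rv1[OF ind] indep_var_rv2[OF ind] by auto
  have sum: "(\<lambda>\<omega>. \<bar>\<Sum>i\<in>insert i I. Y i \<omega>\<bar> powr p) = (\<lambda>\<omega>. \<bar>(\<Sum>i\<in>I. Y i \<omega>) + Y i \<omega>\<bar> powr p)"
    using insert.hyps by (simp add: add.commute)
  have int: "integrable M (\<lambda>\<omega>. \<bar>\<Sum>i\<in>insert i I. Y i \<omega>\<bar> powr p)"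
    unfolding sum by (rule integrable_powr_add) (use IH(1) Yi p in auto)
  let ?S = "expectation (\<lambda>\<omega>. \<bar>\<Sum>i\<in>I. Y i \<omega>\<bar> powr p)"
  define e where "e = moment_exponent p"
  have C: "powr_const p > 0" by (rule powr_const_pos[OF p])
  have "expectation (\<lambda>\<omega>. \<bar>\<Sum>i\<in>insert i I. Y i \<omega>\<bar> powr p) \<le> moment_const p B * (real (card I) + 1) powr e"
  proof (cases "p \<le> 2")
    case True
    have e: "e = 1" using True by (simp add: e_def moment_exponent_def)
    have "expectation (\<lambda>\<omega>. \<bar>\<Sum>i\<in>insert i I. Y i \<omega>\<bar> powr p) \<le>
        ?S + powr_const p * expectation (\<lambda>\<omega>. \<bar>Y i \<omega>\<bar> powr p)"
      unfolding sum by (rule moment_add_small[OF p True ind IH(1) Yi(1,2)])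
    also have "\<dots> \<le> moment_const p B * real (card I) + powr_const p * B"
      using IH(2) Yi(3) C e by (intro add_mono mult_left_mono) (auto simp: e_def)
    also have "\<dots> = moment_const p B * (real (card I) + 1) powr e"
      using True e by (simp add: moment_const_def algebra_simps)
    finally show ?thesis .
  next
    case False
    then have p2: "2 < p" by simp
    have e: "e = p / 2" using False by (simp add: e_def moment_exponent_def)
    define \<eta> where "\<eta> = p / (4 * powr_const p * (1 + B))"
    have \<eta>: "\<eta> > 0" using C p B0 by (simp add: \<eta>_def)
    define K where "K = moment_const p B"
    have aux0: "moment_aux p B \<ge> 0" using C B0 by (simp add: moment_aux_def)
    have K: "K = B + 4 * moment_aux p B / p" using False by (simp add: K_def moment_const_def)
    have BK: "B \<le> K" using aux0 p by (simp add: K)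
    show ?thesis
    \<comment> \<open>The recursion divides by \<open>card I\<close>, so the first summand is
      treated apart, using \<open>B \<le> K\<close>.\<close>
    proof (cases "I = {}")
      case True
      then show ?thesis using Yi(3) BK p by (simp add: K_def)
    next
      case False
      define k where "k = real (card I)"
      have k: "k \<ge> 1" using False insert.hyps by (simp add: k_def Suc_le_eq card_gt_0_iff)
      have cnv: "powr_const p * \<eta> * (1 + B) = p / 4"
      proof -
        define D where "D = powr_const p * (1 + B)"
        have "D > 0" using C B0 by (simp add: D_def)
        have "\<eta> = p / (4 * D)" by (simp add: \<eta>_def D_def mult.assoc)
        then have "D * \<eta> = p / 4" using \<open>D > 0\<close> by simp
        then show ?thesis by (simp add: D_def mult_ac)
      qed
      \<comment> \<open>The constant \<open>B\<close> is inflated to the order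
        \<open>k powr (e - 1)\<close>, so that all lower-order terms combine into
        \<open>moment_aux p B\<close>.\<close>
      have "1 \<le> k powr (e - 1)" using k e p2 by (intro ge_one_powr_ge_zero) auto
      then have Bk: "B \<le> B * k powr (e - 1)" using B0 by (simp add: mult_le_cancel_left1)
      have kd: "(k / \<eta>) powr (e - 1) = k powr (e - 1) * \<eta> powr (1 - e)"
        using k \<eta> by (simp add: powr_divide powr_minus_divide[symmetric] divide_powr_uminus)
      have ke: "k powr e = k * k powr (e - 1)" using k by (simp add: powr_diff)
      have S: "?S \<le> K * k powr e" using IH(2) by (simp add: K_def k_def e_def)
      have "expectation (\<lambda>\<omega>. \<bar>\<Sum>i\<in>insert i I. Y i \<omega>\<bar> powr p) \<le>
          ?S + powr_const p * ((\<eta> * ?S / k + (k / \<eta>) powr (e - 1)) * (1 + B) + B)"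
        unfolding sum e using k by (intro moment_add_large[OF p2 \<eta> _ ind IH(1) Yi]) auto
      also have "\<dots> = ?S + (powr_const p * \<eta> * (1 + B)) * (?S / k)
          + powr_const p * (k powr (e - 1) * \<eta> powr (1 - e) * (1 + B) + B)"
        unfolding kd by (simp add: algebra_simps)
      also have "\<dots> \<le> K * k powr e + (p / 4) * (K * k powr e / k)
          + powr_const p * (k powr (e - 1) * \<eta> powr (1 - e) * (1 + B) + B * k powr (e - 1))"
        unfolding cnv using S k p C Bk by (intro add_mono mult_left_mono divide_right_mono) auto
      also have "\<dots> = K * k powr e + ((p / 4) * K + moment_aux p B) * k powr (e - 1)"
        unfolding moment_aux_def \<eta>_def[symmetric] e[symmetric] using k by (simp add: ke algebra_simps)
      also have "\<dots> \<le> K * k powr e + (e * K) * k powr (e - 1)"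
      proof (intro add_left_mono mult_right_mono)
        have "moment_aux p B \<le> (p / 4) * K" using p B0 by (simp add: K field_simps)
        moreover have "e * K = p / 4 * K + p / 4 * K" by (simp add: e)
        ultimately show "p / 4 * K + moment_aux p B \<le> e * K" by linarith
      qed simp
      \<comment> \<open>In this form Bernoulli's inequality bounds
        \<open>k powr e + e * k powr (e - 1)\<close> by \<open>(k + 1) powr e\<close>.\<close>
      also have "\<dots> = K * (k powr e * (1 + e * (1 / k)))" using k by (simp add: ke algebra_simps)
      also have "\<dots> \<le> K * (k powr e * (1 + 1 / k) powr e)"
        using k e p2 B0 BK by (intro mult_left_mono one_plus_powr_ge) auto
      also have "k powr e * (1 + 1 / k) powr e = (k * (1 + 1 / k)) powr e" using k by (simp add: powr_mult)
      also have "k * (1 + 1 / k) = k + 1" using k by (simp add: field_simps)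
      finally show ?thesis by (simp add: K_def k_def)
    qed
  qed
  then show ?case using int insert.hyps by (simp add: e_def add.commute)
qed

lemma sample_mean_tail:
  fixes Z :: "'i \<Rightarrow> 'a \<Rightarrow> real"
  assumes p: "1 < p" and "finite I" "I \<noteq> {}" and indep: "indep_vars (\<lambda>_. borel) Z I"
    and "\<And>i. i \<in> I \<Longrightarrow> integrable M (\<lambda>\<omega>. \<bar>Z i \<omega> - \<theta>\<bar> powr p)"
    and "\<And>i. i \<in> I \<Longrightarrow> expectation (\<lambda>\<omega>. Z i \<omega> - \<theta>) = 0"
    and "\<And>i. i \<in> I \<Longrightarrow> expectation (\<lambda>\<omega>. \<bar>Z i \<omega> - \<theta>\<bar> powr p) \<le> B"
    and \<epsilon>: "\<epsilon> > 0"
  shows "prob {\<omega> \<in> space M. \<bar>(\<Sum>i\<in>I. Z i \<omega>) / real (card I) - \<theta>\<bar> \<ge> \<epsilon>} \<le>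
    moment_const p B * \<epsilon> powr (- p) * real (card I) powr (moment_exponent p - p)"
proof -
  define k where "k = real (card I)"
  have k: "k > 0" using assms by (simp add: k_def card_gt_0_iff)
  obtain i where i: "i \<in> I" using assms by auto
  have "0 \<le> expectation (\<lambda>\<omega>. \<bar>Z i \<omega> - \<theta>\<bar> powr p)" by simp
  then have B: "B \<ge> 0" using assms(7)[OF i] by linarith
  have iv: "indep_vars (\<lambda>_. borel) (\<lambda>i \<omega>. Z i \<omega> - \<theta>) I"
    by (rule indep_vars_compose2[OF indep, where Y="\<lambda>_ z. z - \<theta>"]) auto
  let ?S = "\<lambda>\<omega>. \<Sum>i\<in>I. Z i \<omega> - \<theta>"
  have m: "integrable M (\<lambda>\<omega>. \<bar>?S \<omega>\<bar> powr p)"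
     "expectation (\<lambda>\<omega>. \<bar>?S \<omega>\<bar> powr p) \<le> moment_const p B * k powr moment_exponent p"
    using moment_sum[OF p B assms(2) iv assms(5,6,7)] by (auto simp: k_def)
  have eq: "(\<Sum>i\<in>I. Z i \<omega>) / k - \<theta> = ?S \<omega> / k" for \<omega>
    using k by (simp add: sum_subtractf k_def field_simps)
  have iff: "\<epsilon> \<le> \<bar>(\<Sum>i\<in>I. Z i \<omega>) / k - \<theta>\<bar> \<longleftrightarrow> (\<epsilon> * k) powr p \<le> \<bar>?S \<omega>\<bar> powr p" for \<omega>
  proof -
    have "\<epsilon> \<le> \<bar>(\<Sum>i\<in>I. Z i \<omega>) / k - \<theta>\<bar> \<longleftrightarrow> \<epsilon> * k \<le> \<bar>?S \<omega>\<bar>"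
      unfolding eq using k by (simp add: field_simps)
    also have "\<dots> \<longleftrightarrow> (\<epsilon> * k) powr p \<le> \<bar>?S \<omega>\<bar> powr p"
    proof
      assume "\<epsilon> * k \<le> \<bar>?S \<omega>\<bar>"
      then show "(\<epsilon> * k) powr p \<le> \<bar>?S \<omega>\<bar> powr p" using p k \<epsilon> by (intro powr_mono2) auto
    next
      assume le: "(\<epsilon> * k) powr p \<le> \<bar>?S \<omega>\<bar> powr p"
      show "\<epsilon> * k \<le> \<bar>?S \<omega>\<bar>"
      proof (rule ccontr)
        assume "\<not> \<epsilon> * k \<le> \<bar>?S \<omega>\<bar>"
        then have "\<bar>?S \<omega>\<bar> powr p < (\<epsilon> * k) powr p" using p by (intro powr_less_mono2) auto
        then show False using le by simp
      qed
    qed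
    finally show ?thesis .
  qed
  have "prob {\<omega> \<in> space M. \<epsilon> \<le> \<bar>(\<Sum>i\<in>I. Z i \<omega>) / k - \<theta>\<bar>}
      = prob {\<omega> \<in> space M. (\<epsilon> * k) powr p \<le> \<bar>?S \<omega>\<bar> powr p}" by (simp only: iff)
  also have "\<dots> \<le> expectation (\<lambda>\<omega>. \<bar>?S \<omega>\<bar> powr p) / (\<epsilon> * k) powr p"
    using k \<epsilon> m(1) by (intro integral_Markov_inequality_measure[where A="space M"]) auto
  also have "\<dots> \<le> moment_const p B * k powr moment_exponent p / (\<epsilon> * k) powr p"
    using m(2) by (intro divide_right_mono) auto
  also have "\<dots> = moment_const p B * \<epsilon> powr (- p) * k powr (moment_exponent p - p)"
    using k \<epsilon> by (simp add: powr_mult powr_diff powr_minus divide_simps)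
  finally show ?thesis by (simp add: k_def)
qed

end

section \<open>The exploration sequence\<close>

lemma explore_subset: "explore p v t \<subseteq> {1..t}"
  by (induction t) auto

lemma finite_explore [simp]: "finite (explore p v t)"
  by (rule finite_subset[OF explore_subset]) simp

text \<open>Step \<open>t\<close> can only add \<open>t\<close> itself, so membership of
  \<open>s\<close> is settled at step \<open>s\<close>.\<close>

lemma explore_mem_iff: "s \<le> t \<Longrightarrow> s \<in> explore p v t \<longleftrightarrow> s \<in> explore p v s"
proof (induction t)
  case (Suc t)
  then show ?case by (cases "s = Suc t") auto
qed simp

lemma explore_exponent_pos: "p > 1 \<Longrightarrow> 0 < explore_exponent p"
  and explore_exponent_le: "p > 1 \<Longrightarrow> explore_exponent p \<le> 1"
  by (auto simp: explore_exponent_def field_simps)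

text \<open>A time is added only while the count is below a nondecreasing threshold, so the
  overshoot is at most \<open>1\<close>.\<close>

lemma card_explore_le:
  assumes "p > 1" "v > 0"
  shows "real (card (explore p v t)) \<le> v * real t powr explore_exponent p + 1"
proof (induction t)
  case (Suc t)
  have "Suc t \<notin> explore p v t" using explore_subset[of p v t] by auto
  moreover have "v * real t powr explore_exponent p \<le> v * real (Suc t) powr explore_exponent p"
    using assms explore_exponent_pos[of p] by (intro mult_left_mono powr_mono2) auto
  ultimately show ?case using Suc by auto
qed simp

text \<open>At an exploitation time after time 1 the exploration test has failed. Time 1 is excluded
  because it is never explored, whatever the count.\<close>

lemma card_explore_ge:
  assumes "t > 1" "t \<notin> explore p v t"
  shows "v * real t powr explore_exponent p \<le> real (card (explore p v (t - 1)))"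
proof -
  obtain s where "t = Suc s" using assms by (cases t) auto
  then show ?thesis using assms by (auto split: if_splits)
qed

text \<open>The outcome-free counterpart of \<open>observations\<close>: it predicts from ranks
  alone which exploration times serve arm \<open>n\<close>. \<open>dsee_observations\<close> shows
  that the two agree along every trajectory.\<close>

definition explored :: "real \<Rightarrow> real \<Rightarrow> nat \<Rightarrow> nat \<Rightarrow> nat \<Rightarrow> nat set" where
  "explored p v N t n = {s \<in> explore p v t. cyclic_index (card (explore p v s)) N = n}"

text \<open>The rank \<open>card (explore p v s)\<close> numbers the exploration times consecutively
  from 1, so counting times becomes counting indices in a residue class.\<close>

lemma card_explored_eq:
  "card (explored p v N t n) = card {k \<in> {1..card (explore p v t)}. cyclic_index k N = n}"
proof (induction t)
  case (Suc t)
  let ?K = "card (explore p v t)"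
  have notin: "Suc t \<notin> explore p v t" using explore_subset[of p v t] by auto
  show ?case
  proof (cases "explore p v (Suc t) = explore p v t")
    case True
    then show ?thesis using Suc by (simp only: explored_def)
  next
    case False
    then have eq: "explore p v (Suc t) = insert (Suc t) (explore p v t)" by (auto split: if_splits)
    then have K: "card (explore p v (Suc t)) = Suc ?K" using notin by simp
    have fin: "finite (explored p v N t n)" by (simp add: explored_def)
    have "explored p v N (Suc t) n =
        (if cyclic_index (Suc ?K) N = n then insert (Suc t) (explored p v N t n) else explored p v N t n)"
      unfolding explored_def eq using K by auto
    moreover have "Suc t \<notin> explored p v N t n" using notin by (simp add: explored_def)
    moreover have "{k \<in> {1..Suc ?K}. cyclic_index k N = n} =
        (if cyclic_index (Suc ?K) N = n then insert (Suc ?K) {k \<in> {1..?K}. cyclic_index k N = n}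
         else {k \<in> {1..?K}. cyclic_index k N = n})"
      by (auto simp: le_Suc_eq)
    ultimately show ?thesis using Suc fin unfolding K by auto
  qed
qed (simp add: explored_def)

text \<open>Every complete round of \<open>N\<close> explorations serves arm \<open>n\<close> once,
  in round \<open>j\<close> at index \<open>j * N + n\<close>.\<close>

lemma card_explored_ge:
  assumes "n \<in> {1..N}"
  shows "card (explore p v t) div N \<le> card (explored p v N t n)"
proof -
  let ?K = "card (explore p v t)"
  have "(\<lambda>j. j * N + n) ` {..<?K div N} \<subseteq> {k \<in> {1..?K}. cyclic_index k N = n}"
  proof safe
    fix j assume "j < ?K div N"
    then have "Suc j * N \<le> ?K div N * N" by (intro mult_le_mono1) auto
    also have "\<dots> \<le> ?K" by simp
    finally show "j * N + n \<in> {1..?K}" using assms by simp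
    have "(j * N + n - 1) mod N = (n - 1 + j * N) mod N" using assms by (simp add: add.commute)
    also have "\<dots> = (n - 1) mod N" by (rule mod_mult_self1)
    also have "\<dots> = n - 1" using assms by (intro mod_less) auto
    finally show "cyclic_index (j * N + n) N = n" using assms by (simp add: cyclic_index_def)
  qed
  moreover have "inj_on (\<lambda>j. j * N + n) {..<?K div N}" using assms by (auto simp: inj_on_def)
  ultimately have "card {..<?K div N} \<le> card {k \<in> {1..?K}. cyclic_index k N = n}"
    by (intro card_inj_on_le) auto
  then show ?thesis by (simp add: card_explored_eq)
qed

section \<open>Independence of the current reward from the past\<close>

definition arm_at :: "(nat \<Rightarrow> 'u \<Rightarrow> history \<Rightarrow> nat) \<Rightarrow> ('a \<Rightarrow> 'u) \<Rightarrow> (nat \<Rightarrow> nat \<Rightarrow> 'a \<Rightarrow> real) \<Rightarrow> nat \<Rightarrow> 'a \<Rightarrow> nat" where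
  "arm_at \<pi> U X t \<omega> = played \<pi> (U \<omega>) (\<lambda>n s. X n s \<omega>) t"

definition history_at :: "(nat \<Rightarrow> 'u \<Rightarrow> history \<Rightarrow> nat) \<Rightarrow> ('a \<Rightarrow> 'u) \<Rightarrow> (nat \<Rightarrow> nat \<Rightarrow> 'a \<Rightarrow> real) \<Rightarrow> nat \<Rightarrow> 'a \<Rightarrow> history" where
  "history_at \<pi> U X t \<omega> = (\<lambda>s\<in>{1..<t}. (arm_at \<pi> U X s \<omega>, X (arm_at \<pi> U X s \<omega>) s \<omega>))"

lemma arm_at_eq: "arm_at \<pi> U X t \<omega> = \<pi> t (U \<omega>) (history_at \<pi> U X t \<omega>)"
  unfolding arm_at_def history_at_def restrict_def by (subst played.simps) simp

lemma history_at_space: "history_at \<pi> U X t \<omega> \<in> space (history_space t)"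
  by (simp add: history_at_def history_space_def space_PiM space_pair_measure)

text \<open>\<open>G\<close> is left general because it is used both as \<open>M\<close> and, in
  \<open>arm_at_past\<close>, as the sigma-algebra of the past. The history is assembled from
  earlier arms, and picking a reward by a measurable index from a countable set preserves
  measurability.\<close>

lemma arm_at_measurable:
  assumes pol: "is_policy N S \<pi>" and U: "U \<in> G \<rightarrow>\<^sub>M S"
  shows "t \<ge> 1 \<Longrightarrow> (\<And>n s. n \<in> {1..N} \<Longrightarrow> 1 \<le> s \<Longrightarrow> s < t \<Longrightarrow> X n s \<in> borel_measurable G) \<Longrightarrow>
    arm_at \<pi> U X t \<in> G \<rightarrow>\<^sub>M count_space {1..N}"
proof (induction t rule: less_induct)
  case (less t)
  have arm: "arm_at \<pi> U X s \<in> G \<rightarrow>\<^sub>M count_space {1..N}" if "s \<in> {1..<t}" for s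
    using that less.prems by (intro less.IH) auto
  have hist: "history_at \<pi> U X t \<in> G \<rightarrow>\<^sub>M history_space t"
    unfolding history_at_def history_space_def
  proof (rule measurable_restrict, rule measurable_Pair)
    fix s assume s: "s \<in> {1..<t}"
    show "(\<lambda>\<omega>. arm_at \<pi> U X s \<omega>) \<in> G \<rightarrow>\<^sub>M count_space UNIV"
      by (rule measurable_compose[OF arm[OF s]]) simp
    show "(\<lambda>\<omega>. X (arm_at \<pi> U X s \<omega>) s \<omega>) \<in> borel_measurable G"
      by (rule measurable_compose_countable'[where f="\<lambda>n. X n s", OF _ arm[OF s]])
        (use s less.prems in auto)
  qed
  have "(\<lambda>\<omega>. (U \<omega>, history_at \<pi> U X t \<omega>)) \<in> G \<rightarrow>\<^sub>M S \<Otimes>\<^sub>M history_space t"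
    using U hist by (rule measurable_Pair)
  moreover have "(\<lambda>(u, h). \<pi> t u h) \<in> S \<Otimes>\<^sub>M history_space t \<rightarrow>\<^sub>M count_space {1..N}"
    using pol less.prems by (simp add: is_policy_def)
  ultimately have "(\<lambda>\<omega>. (\<lambda>(u, h). \<pi> t u h) (U \<omega>, history_at \<pi> U X t \<omega>)) \<in> G \<rightarrow>\<^sub>M count_space {1..N}"
    by (rule measurable_compose)
  then show ?case by (simp add: arm_at_eq[symmetric])
qed

context bandit
begin

lemma reward_measurable [measurable]:
  assumes "n \<in> {1..N}" "t \<ge> 1"
  shows "X n t \<in> borel_measurable M"
  using rewards_integrable[OF assms] by auto

lemma expectation_reward:
  assumes "n \<in> {1..N}" "t \<ge> 1"
  shows "expectation (X n t) = arm_mean f n"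
  unfolding arm_mean_def rewards_distr[OF assms, symmetric]
  using assms by (subst integral_distr) auto

lemma arm_at_random_variable:
  assumes "is_policy N S \<pi>" "t \<ge> 1"
  shows "arm_at \<pi> U X t \<in> M \<rightarrow>\<^sub>M count_space {1..N}"
  by (rule arm_at_measurable[OF assms(1) seed_measurable assms(2)]) (rule reward_measurable)

definition table :: "(nat \<times> nat) set \<Rightarrow> 'a \<Rightarrow> nat \<times> nat \<Rightarrow> real" where
  "table J \<omega> = (\<lambda>(n, s)\<in>J. X n s \<omega>)"

text \<open>Rectangles in seed and earlier rewards: an intersection-stable generator of the past, on
  which independence can be checked by multiplying probabilities.\<close>

definition past_sets :: "nat \<Rightarrow> 'a set set" where
  "past_sets t = {U -` B \<inter> table ({1..N} \<times> {1..<t}) -` C \<inter> space M |B C.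
     B \<in> sets S \<and> C \<in> sets (Pi\<^sub>M ({1..N} \<times> {1..<t}) (\<lambda>_. borel))}"

lemma table_measurable:
  assumes "J \<subseteq> {1..N} \<times> {1..}"
  shows "table J \<in> M \<rightarrow>\<^sub>M Pi\<^sub>M J (\<lambda>_. borel)"
  unfolding table_def using assms by (intro measurable_restrict) (auto intro!: reward_measurable)

lemma seed_table_prob:
  assumes "B \<in> sets S" "E \<in> sets (Pi\<^sub>M ({1..N} \<times> {1..}) (\<lambda>_. borel))"
  shows "prob (U -` B \<inter> table ({1..N} \<times> {1..}) -` E \<inter> space M) =
    prob (U -` B \<inter> space M) * prob (table ({1..N} \<times> {1..}) -` E \<inter> space M)"
proof -
  have "prob ((U -` B \<inter> space M) \<inter> (table ({1..N} \<times> {1..}) -` E \<inter> space M)) =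
    prob (U -` B \<inter> space M) * prob (table ({1..N} \<times> {1..}) -` E \<inter> space M)"
    using assms unfolding table_def[abs_def] by (intro indep_setD[OF seed_indep]) auto
  then show ?thesis by (simp add: Int_ac)
qed

text \<open>The seed is assumed independent of the complete reward table, so the joint event of past
  and current reward is first written as a set \<open>E\<close> of complete tables. Independence of
  rewards with disjoint index sets then separates past from present.\<close>

lemma seed_past_reward_prob:
  assumes n: "n \<in> {1..N}" and t: "t \<ge> 1" and B: "B \<in> sets S"
    and C: "C \<in> sets (Pi\<^sub>M ({1..N} \<times> {1..<t}) (\<lambda>_. borel))" and D: "D \<in> sets borel"
  shows "prob (U -` B \<inter> table ({1..N} \<times> {1..<t}) -` C \<inter> X n t -` D \<inter> space M) =
    prob (U -` B \<inter> space M) * prob (table ({1..N} \<times> {1..<t}) -` C \<inter> space M) *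
    prob (X n t -` D \<inter> space M)"
proof -
  let ?I = "{1..N} \<times> {1::nat..}" and ?J = "{1..N} \<times> {1..<t}"
  let ?PI = "Pi\<^sub>M ?I (\<lambda>_. borel :: real measure)" and ?PJ = "Pi\<^sub>M ?J (\<lambda>_. borel :: real measure)"
  define E where "E = {w \<in> space ?PI. restrict w ?J \<in> C \<and> w (n, t) \<in> D}"
  have [measurable]: "(\<lambda>w. restrict w ?J) \<in> ?PI \<rightarrow>\<^sub>M ?PJ" by (rule measurable_restrict_subset) auto
  have [measurable]: "(\<lambda>w. w (n, t)) \<in> ?PI \<rightarrow>\<^sub>M borel"
    using n t by (intro measurable_component_singleton) auto
  note [measurable] = C D
  have E: "E \<in> sets ?PI" unfolding E_def by measurable
  have sp: "table ?I \<omega> \<in> space ?PI" for \<omega> by (simp add: table_def space_PiM)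
  have res: "restrict (table ?I \<omega>) ?J = table ?J \<omega>" for \<omega>
    by (auto simp: table_def restrict_def fun_eq_iff)
  have app: "table ?I \<omega> (n, t) = X n t \<omega>" for \<omega> using n t by (simp add: table_def)
  have vim: "table ?I -` E = table ?J -` C \<inter> X n t -` D"
    using sp res app by (auto simp: E_def)
  \<comment> \<open>\<open>indep_var_restrict\<close> compares subfamilies, so the current reward is
    viewed as a family over one index, and \<open>D'\<close> is the cylinder over
    \<open>D\<close>.\<close>
  let ?P1 = "Pi\<^sub>M {(n, t)} (\<lambda>_. borel :: real measure)"
  let ?x = "\<lambda>\<omega>. \<lambda>i\<in>{(n, t)}. (case i of (n, t) \<Rightarrow> X n t) \<omega>"
  have "indep_var ?PJ (\<lambda>\<omega>. \<lambda>i\<in>?J. (case i of (n, t) \<Rightarrow> X n t) \<omega>) ?P1 ?x"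
    using n t by (intro indep_var_restrict[OF rewards_indep]) auto
  moreover have "(\<lambda>\<omega>. \<lambda>i\<in>?J. (case i of (n, t) \<Rightarrow> X n t) \<omega>) = table ?J"
    by (auto simp: table_def[abs_def] fun_eq_iff restrict_def)
  ultimately have ind: "indep_var ?PJ (table ?J) ?P1 ?x" by simp
  define D' where "D' = (\<lambda>w. w (n, t)) -` D \<inter> space ?P1"
  have "(\<lambda>w. w (n, t)) \<in> ?P1 \<rightarrow>\<^sub>M borel" by (intro measurable_component_singleton) auto
  then have D': "D' \<in> sets ?P1" unfolding D'_def using D by (rule measurable_sets)
  have x: "?x \<omega> \<in> D' \<longleftrightarrow> X n t \<omega> \<in> D" for \<omega> by (simp add: D'_def space_PiM)
  from indep_varD[OF ind C D']
  have ind: "prob (table ?J -` C \<inter> X n t -` D \<inter> space M) =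
      prob (table ?J -` C \<inter> space M) * prob (X n t -` D \<inter> space M)"
    by (simp add: vimage_def Int_def x del: restrict_apply)
  have "U -` B \<inter> table ?J -` C \<inter> X n t -` D \<inter> space M = U -` B \<inter> table ?I -` E \<inter> space M"
    unfolding vim by auto
  then show ?thesis using seed_table_prob[OF B E] ind unfolding vim by simp
qed

lemma past_indep:
  assumes n: "n \<in> {1..N}" and t: "t \<ge> 1"
  shows "indep_set (sigma_sets (space M) (past_sets t))
    (sigma_sets (space M) {X n t -` D \<inter> space M |D. D \<in> sets borel})"
proof (rule indep_set_sigma_sets)
  let ?J = "{1..N} \<times> {1..<t}"
  let ?PJ = "Pi\<^sub>M ?J (\<lambda>_. borel :: real measure)"
  have tab: "table ?J \<in> M \<rightarrow>\<^sub>M ?PJ" by (rule table_measurable) auto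
  have Xm: "X n t \<in> M \<rightarrow>\<^sub>M borel" using n t by (rule reward_measurable)
  show "indep_set (past_sets t) {X n t -` D \<inter> space M |D. D \<in> sets borel}"
  proof (rule indep_setI)
    show "past_sets t \<subseteq> events"
    proof
      fix a assume "a \<in> past_sets t"
      then obtain B C where BC: "B \<in> sets S" "C \<in> sets ?PJ" "a = U -` B \<inter> table ?J -` C \<inter> space M"
        by (auto simp: past_sets_def)
      have "a = (U -` B \<inter> space M) \<inter> (table ?J -` C \<inter> space M)" using BC(3) by auto
      then show "a \<in> events"
        using measurable_sets[OF seed_measurable BC(1)] measurable_sets[OF tab BC(2)] by simp
    qed
    show "{X n t -` D \<inter> space M |D. D \<in> sets borel} \<subseteq> events"
      using measurable_sets[OF Xm] by auto
  next
    fix a b assume a: "a \<in> past_sets t" and b: "b \<in> {X n t -` D \<inter> space M |D. D \<in> sets borel}"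
    obtain B C where BC: "B \<in> sets S" "C \<in> sets ?PJ" "a = U -` B \<inter> table ?J -` C \<inter> space M"
      using a by (auto simp: past_sets_def)
    obtain D where D: "D \<in> sets borel" "b = X n t -` D \<inter> space M" using b by auto
    have ab: "a \<inter> b = U -` B \<inter> table ?J -` C \<inter> X n t -` D \<inter> space M" using BC(3) D(2) by auto
    \<comment> \<open>The choice \<open>UNIV\<close> for the reward event leaves only the seed and
      past factors.\<close>
    have pa: "prob a = prob (U -` B \<inter> space M) * prob (table ?J -` C \<inter> space M)"
      using seed_past_reward_prob[OF n t BC(1,2), of UNIV] BC(3) by (simp add: prob_space)
    have "prob (a \<inter> b) = prob a * prob (X n t -` D \<inter> space M)"
      unfolding ab pa by (rule seed_past_reward_prob[OF n t BC(1,2) D(1)])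
    then show "prob (a \<inter> b) = prob a * prob b" using D(2) by simp
  qed
  show "Int_stable (past_sets t)"
  proof (rule Int_stableI)
    fix a a' assume a: "a \<in> past_sets t" and a': "a' \<in> past_sets t"
    obtain B C where BC: "B \<in> sets S" "C \<in> sets ?PJ" "a = U -` B \<inter> table ?J -` C \<inter> space M"
      using a by (auto simp: past_sets_def)
    obtain B' C' where BC': "B' \<in> sets S" "C' \<in> sets ?PJ" "a' = U -` B' \<inter> table ?J -` C' \<inter> space M"
      using a' by (auto simp: past_sets_def)
    have "a \<inter> a' = U -` (B \<inter> B') \<inter> table ?J -` (C \<inter> C') \<inter> space M" using BC(3) BC'(3) by auto
    then show "a \<inter> a' \<in> past_sets t" unfolding past_sets_def using BC BC' by blast
  qed
  show "Int_stable {X n t -` D \<inter> space M |D. D \<in> sets borel}"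
  proof (rule Int_stableI)
    fix a b assume "a \<in> {X n t -` D \<inter> space M |D. D \<in> sets borel}" "b \<in> {X n t -` D \<inter> space M |D. D \<in> sets borel}"
    then obtain D D' where "D \<in> sets borel" "D' \<in> sets borel" "a \<inter> b = X n t -` (D \<inter> D') \<inter> space M"
      by auto
    then show "a \<inter> b \<in> {X n t -` D \<inter> space M |D. D \<in> sets borel}" by blast
  qed
qed

text \<open>A seed event, or an event of one earlier reward, is a rectangle whose other side is the
  whole space. Hence both are measurable for the generated sigma-algebra, and
  \<open>arm_at_measurable\<close> applies to it.\<close>

lemma arm_at_past:
  assumes pol: "is_policy N S \<pi>" and t: "t \<ge> 1"
  shows "{\<omega> \<in> space M. arm_at \<pi> U X t \<omega> = n} \<in> sigma_sets (space M) (past_sets t)"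
proof -
  let ?J = "{1..N} \<times> {1..<t}"
  let ?PJ = "Pi\<^sub>M ?J (\<lambda>_. borel :: real measure)"
  define G where "G = sigma (space M) (past_sets t)"
  have sub: "past_sets t \<subseteq> Pow (space M)" by (auto simp: past_sets_def)
  have spG: "space G = space M" and setsG: "sets G = sigma_sets (space M) (past_sets t)"
    using sub by (simp_all add: G_def)
  have Usp: "U \<omega> \<in> space S" if "\<omega> \<in> space M" for \<omega> using that measurable_space[OF seed_measurable] by simp
  have tsp: "table ?J \<omega> \<in> space ?PJ" for \<omega> by (simp add: table_def space_PiM)
  have UG: "U \<in> G \<rightarrow>\<^sub>M S"
  proof (rule measurableI)
    fix B assume B: "B \<in> sets S"
    have "U -` B \<inter> space G = U -` B \<inter> table ?J -` space ?PJ \<inter> space M" using tsp spG by auto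
    then have "U -` B \<inter> space G \<in> past_sets t" unfolding past_sets_def using B by blast
    then show "U -` B \<inter> space G \<in> sets G" unfolding setsG by (rule sigma_sets.Basic)
  qed (simp add: spG Usp)
  have XG: "X m s \<in> borel_measurable G" if ms: "m \<in> {1..N}" "1 \<le> s" "s < t" for m s
  proof (rule measurableI)
    fix D :: "real set" assume D: "D \<in> sets borel"
    define C where "C = (\<lambda>w. w (m, s)) -` D \<inter> space ?PJ"
    have "(\<lambda>w. w (m, s)) \<in> ?PJ \<rightarrow>\<^sub>M borel" using ms by (intro measurable_component_singleton) auto
    then have C: "C \<in> sets ?PJ" unfolding C_def using D by (rule measurable_sets)
    have "X m s -` D \<inter> space G = U -` space S \<inter> table ?J -` C \<inter> space M"
      using tsp Usp ms spG by (auto simp: C_def table_def)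
    then have "X m s -` D \<inter> space G \<in> past_sets t" unfolding past_sets_def using C by blast
    then show "X m s -` D \<inter> space G \<in> sets G" unfolding setsG by (rule sigma_sets.Basic)
  qed simp
  have am: "arm_at \<pi> U X t \<in> G \<rightarrow>\<^sub>M count_space {1..N}"
    by (rule arm_at_measurable[OF pol UG t XG])
  have "{\<omega> \<in> space M. arm_at \<pi> U X t \<omega> = n} = arm_at \<pi> U X t -` ({n} \<inter> {1..N}) \<inter> space G"
    using measurable_space[OF am] by (auto simp: spG)
  also have "\<dots> \<in> sets G" by (rule measurable_sets[OF am]) auto
  finally show ?thesis by (simp add: setsG)
qed

text \<open>The indicator of the choice depends only on the past, so it is independent of the fresh
  reward and the expectation factors.\<close>

lemma expectation_reward_arm:
  assumes pol: "is_policy N S \<pi>" and n: "n \<in> {1..N}" and t: "t \<ge> 1"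
  shows "integrable M (\<lambda>\<omega>. X n t \<omega> * indicat_real {\<omega> \<in> space M. arm_at \<pi> U X t \<omega> = n} \<omega>)"
    and "expectation (\<lambda>\<omega>. X n t \<omega> * indicat_real {\<omega> \<in> space M. arm_at \<pi> U X t \<omega> = n} \<omega>) =
      arm_mean f n * prob {\<omega> \<in> space M. arm_at \<pi> U X t \<omega> = n}"
proof -
  let ?A = "{\<omega> \<in> space M. arm_at \<pi> U X t \<omega> = n}"
  note past = past_indep[OF n t]
  have Am: "?A \<in> sigma_sets (space M) (past_sets t)" by (rule arm_at_past[OF pol t])
  have A: "?A \<in> events" using indep_setD_ev1[OF past] Am by auto
  have sub: "past_sets t \<subseteq> Pow (space M)" by (auto simp: past_sets_def)
  have "indicat_real ?A \<in> borel_measurable (sigma (space M) (past_sets t))"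
    using Am sub by (intro borel_measurable_indicator) simp
  then have gen: "{indicat_real ?A -` D \<inter> space M |D. D \<in> sets borel} \<subseteq> sigma_sets (space M) (past_sets t)"
    using sub by (auto simp: measurable_def)
  have "indep_var borel (X n t) borel (indicat_real ?A)"
    unfolding indep_var_eq
  proof (intro conjI indep_setI)
    show Xm: "X n t \<in> borel_measurable M" using n t by (rule reward_measurable)
    show "indicat_real ?A \<in> borel_measurable M" using A by (rule borel_measurable_indicator)
    show "sigma_sets (space M) {X n t -` D \<inter> space M |D. D \<in> sets borel} \<subseteq> events"
      by (rule indep_setD_ev2[OF past])
    have gen': "sigma_sets (space M) {indicat_real ?A -` D \<inter> space M |D. D \<in> sets borel}
        \<subseteq> sigma_sets (space M) (past_sets t)"
      by (rule sigma_sets_mono[OF gen])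
    then show "sigma_sets (space M) {indicat_real ?A -` D \<inter> space M |D. D \<in> sets borel} \<subseteq> events"
      using indep_setD_ev1[OF past] by auto
    fix a b assume "a \<in> sigma_sets (space M) {X n t -` D \<inter> space M |D. D \<in> sets borel}"
      "b \<in> sigma_sets (space M) {indicat_real ?A -` D \<inter> space M |D. D \<in> sets borel}"
    then have "prob (b \<inter> a) = prob b * prob a" using gen' by (intro indep_setD[OF past]) auto
    then show "prob (a \<inter> b) = prob a * prob b" by (simp add: Int_commute mult.commute)
  qed
  note ind = this
  have Ai: "integrable M (indicat_real ?A)" using A by (intro integrable_real_indicator) (auto simp: less_top[symmetric])
  show "integrable M (\<lambda>\<omega>. X n t \<omega> * indicat_real ?A \<omega>)"
    by (rule indep_var_integrable[OF ind rewards_integrable[OF n t] Ai])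
  show "expectation (\<lambda>\<omega>. X n t \<omega> * indicat_real ?A \<omega>) = arm_mean f n * prob ?A"
    using indep_var_lebesgue_integral[OF ind rewards_integrable[OF n t] Ai] A
    by (simp add: expectation_reward[OF n t] Int_absorb2[OF sets.sets_into_space])
qed

text \<open>The probabilities of the arms sum to 1 at each time, so \<open>T * \<mu>\<close> can be
  spread over the same events as the rewards. Regret then becomes gaps weighted by probabilities of
  play.\<close>

lemma regret_eq:
  assumes pol: "is_policy N S \<pi>"
  shows "regret M U X \<mu> \<pi> T =
    (\<Sum>t=1..T. \<Sum>n=1..N. (\<mu> - arm_mean f n) * prob {\<omega> \<in> space M. arm_at \<pi> U X t \<omega> = n})"
proof -
  let ?A = "\<lambda>t n. {\<omega> \<in> space M. arm_at \<pi> U X t \<omega> = n}"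
  have arm: "arm_at \<pi> U X t \<omega> \<in> {1..N}" if "t \<ge> 1" "\<omega> \<in> space M" for t \<omega>
    using measurable_space[OF arm_at_random_variable[OF pol that(1)] that(2)] by simp
  have rew: "policy_reward \<pi> U X t \<omega> = (\<Sum>n=1..N. X n t \<omega> * indicat_real (?A t n) \<omega>)"
    if "t \<ge> 1" "\<omega> \<in> space M" for t \<omega>
  proof -
    have "(\<Sum>n=1..N. X n t \<omega> * indicat_real (?A t n) \<omega>) =
        (\<Sum>n=1..N. if n = arm_at \<pi> U X t \<omega> then X n t \<omega> else 0)"
      using that by (intro sum.cong) (auto simp: indicator_def)
    also have "\<dots> = X (arm_at \<pi> U X t \<omega>) t \<omega>" using arm[OF that] by simp
    finally show ?thesis by (simp add: policy_reward_def arm_at_def)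
  qed
  have "(\<integral>\<omega>. (\<Sum>t=1..T. policy_reward \<pi> U X t \<omega>) \<partial>M) =
      (\<integral>\<omega>. (\<Sum>t=1..T. \<Sum>n=1..N. X n t \<omega> * indicat_real (?A t n) \<omega>) \<partial>M)"
    by (intro Bochner_Integration.integral_cong sum.cong rew) auto
  also have "\<dots> = (\<Sum>t=1..T. \<integral>\<omega>. (\<Sum>n=1..N. X n t \<omega> * indicat_real (?A t n) \<omega>) \<partial>M)"
    by (intro Bochner_Integration.integral_sum Bochner_Integration.integrable_sum
        expectation_reward_arm(1)[OF pol]) auto
  also have "\<dots> = (\<Sum>t=1..T. \<Sum>n=1..N. \<integral>\<omega>. X n t \<omega> * indicat_real (?A t n) \<omega> \<partial>M)"
    by (intro sum.cong refl Bochner_Integration.integral_sum expectation_reward_arm(1)[OF pol]) auto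
  also have "\<dots> = (\<Sum>t=1..T. \<Sum>n=1..N. arm_mean f n * prob (?A t n))"
    by (intro sum.cong refl expectation_reward_arm(2)[OF pol]) auto
  finally have int: "(\<integral>\<omega>. (\<Sum>t=1..T. policy_reward \<pi> U X t \<omega>) \<partial>M) =
      (\<Sum>t=1..T. \<Sum>n=1..N. arm_mean f n * prob (?A t n))" .
  have one: "(\<Sum>n=1..N. prob (?A t n)) = 1" if t: "t \<ge> 1" for t
  proof -
    have meas: "?A t n \<in> events" if "n \<in> {1..N}" for n
      using indep_setD_ev1[OF past_indep[OF that t]] arm_at_past[OF pol t] by auto
    have "(\<Sum>n=1..N. prob (?A t n)) = prob (\<Union>n\<in>{1..N}. ?A t n)"
      using meas by (intro finite_measure_finite_Union[symmetric]) (auto simp: disjoint_family_on_def)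
    also have "(\<Union>n\<in>{1..N}. ?A t n) = space M" using arm[OF t] by auto
    finally show ?thesis by (simp add: prob_space)
  qed
  have "(\<Sum>t=1..T. \<Sum>n=1..N. \<mu> * prob (?A t n)) = (\<Sum>t=1..T. \<mu>)"
  proof (rule sum.cong)
    fix t assume "t \<in> {1..T}"
    then show "(\<Sum>n=1..N. \<mu> * prob (?A t n)) = \<mu>"
      using one[of t] by (simp add: sum_distrib_left[symmetric])
  qed simp
  then have "real T * \<mu> = (\<Sum>t=1..T. \<Sum>n=1..N. \<mu> * prob (?A t n))" by simp
  then show ?thesis unfolding regret_def int
    by (simp add: sum_subtractf left_diff_distrib)
qed

end

section \<open>Regret of exploitation and total regret\<close>

text \<open>The balance that determines the exploration rate: with about
  \<open>t powr \<alpha>\<close> observations the tail bound becomes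
  \<open>t powr (\<alpha> - 1)\<close>, whose sum has the order of the exploration cost.\<close>

lemma explore_exponent_moment:
  assumes "p > 1"
  shows "explore_exponent p * (moment_exponent p - p) = explore_exponent p - 1"
proof (cases "p \<le> 2")
  case True
  then show ?thesis using assms by (simp add: explore_exponent_def moment_exponent_def field_simps)
next
  case False
  have "1 / (1 + p / 2) = 2 / (p + 2)" using assms by (simp add: field_simps)
  then show ?thesis using False by (simp add: explore_exponent_def moment_exponent_def field_simps)
qed

text \<open>\<open>v / (2 * N)\<close> bounds from below the observations per arm in units of
  \<open>t powr \<alpha>\<close>. The factor \<open>N\<close> is a union bound over arms; the
  \<open>1\<close> covers early times when some arm may lack observations.\<close>

definition error_const :: "real \<Rightarrow> real \<Rightarrow> nat \<Rightarrow> real \<Rightarrow> real \<Rightarrow> real" where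
  "error_const p v N B \<epsilon> = (1 + real N * (moment_const p B * \<epsilon> powr (- p))) *
     (v / (2 * real N)) powr (moment_exponent p - p)"

context bandit
begin

lemma reward_central_moment:
  assumes n: "n \<in> {1..N}" and t: "t \<ge> 1" and p: "p > 1" and int: "integrable (f n) (\<lambda>x. \<bar>x\<bar> powr p)"
  shows "integrable M (\<lambda>\<omega>. \<bar>X n t \<omega> - \<theta>\<bar> powr p)"
    and "expectation (\<lambda>\<omega>. \<bar>X n t \<omega> - \<theta>\<bar> powr p) = (\<integral>x. \<bar>x - \<theta>\<bar> powr p \<partial>f n)"
proof -
  have Xm[measurable]: "X n t \<in> borel_measurable M" using n t by (rule reward_measurable)
  have "integrable M (\<lambda>\<omega>. \<bar>X n t \<omega>\<bar> powr p)"
    using int unfolding rewards_distr[OF n t, symmetric] by (subst (asm) integrable_distr_eq) auto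
  then have "integrable M (\<lambda>\<omega>. \<bar>X n t \<omega> + (- \<theta>)\<bar> powr p)"
    by (intro integrable_powr_add) (use p in auto)
  then show "integrable M (\<lambda>\<omega>. \<bar>X n t \<omega> - \<theta>\<bar> powr p)" by simp
  show "expectation (\<lambda>\<omega>. \<bar>X n t \<omega> - \<theta>\<bar> powr p) = (\<integral>x. \<bar>x - \<theta>\<bar> powr p \<partial>f n)"
    unfolding rewards_distr[OF n t, symmetric] by (subst integral_distr) auto
qed

definition estimate :: "nat set \<Rightarrow> nat \<Rightarrow> 'a \<Rightarrow> real" where
  "estimate I n \<omega> = (\<Sum>s\<in>I. X n s \<omega>) / real (card I)"

lemma estimate_tail:
  assumes p: "p > 1" and n: "n \<in> {1..N}" and int: "integrable (f n) (\<lambda>x. \<bar>x\<bar> powr p)"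
    and B: "(\<integral>x. \<bar>x - arm_mean f n\<bar> powr p \<partial>f n) \<le> B"
    and I: "finite I" "I \<noteq> {}" "I \<subseteq> {1..}" and \<epsilon>: "\<epsilon> > 0"
  shows "prob {\<omega> \<in> space M. \<bar>estimate I n \<omega> - arm_mean f n\<bar> \<ge> \<epsilon>} \<le>
    moment_const p B * \<epsilon> powr (- p) * real (card I) powr (moment_exponent p - p)"
proof -
  let ?Z = "\<lambda>(n, t). X n t" and ?J = "{n} \<times> I"
  have iv: "indep_vars (\<lambda>_. borel) ?Z ?J"
    using n I by (intro indep_vars_subset[OF rewards_indep]) auto
  have mem: "\<exists>t\<ge>1. i = (n, t)" if "i \<in> ?J" for i using that I(3) by auto
  have 1: "integrable M (\<lambda>\<omega>. \<bar>?Z i \<omega> - arm_mean f n\<bar> powr p)" if "i \<in> ?J" for i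
    using mem[OF that] reward_central_moment(1)[OF n _ p int] by auto
  have 2: "expectation (\<lambda>\<omega>. ?Z i \<omega> - arm_mean f n) = 0" if "i \<in> ?J" for i
    using mem[OF that] expectation_reward[OF n] rewards_integrable[OF n] by (auto simp: prob_space)
  have 3: "expectation (\<lambda>\<omega>. \<bar>?Z i \<omega> - arm_mean f n\<bar> powr p) \<le> B" if "i \<in> ?J" for i
    using mem[OF that] reward_central_moment(2)[OF n _ p int] B by auto
  have "(\<Sum>i\<in>?J. ?Z i \<omega>) = (\<Sum>s\<in>I. X n s \<omega>)" for \<omega>
  proof -
    have "?J = Pair n ` I" by auto
    then show ?thesis by (simp add: sum.reindex inj_on_def)
  qed
  moreover have "card ?J = card I" by (simp add: card_cartesian_product)
  ultimately have "estimate I n \<omega> = (\<Sum>i\<in>?J. ?Z i \<omega>) / real (card ?J)" "card ?J = card I" for \<omega>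
    by (simp_all add: estimate_def)
  then show ?thesis
    using sample_mean_tail[OF p _ _ iv 1 2 3 \<epsilon>] I by simp
qed

section \<open>Arms and estimates along a trajectory of a DSEE policy\<close>

lemma dsee_explore_arm:
  assumes "is_dsee N A S \<pi>" "s \<ge> 1" "s \<in> A s" "\<omega> \<in> space M"
  shows "arm_at \<pi> U X s \<omega> = cyclic_index (card (A s)) N"
  using assms history_at_space[of \<pi> U X s \<omega>] measurable_space[OF seed_measurable assms(4)]
  unfolding is_dsee_def arm_at_eq by (metis (no_types, lifting))

lemma dsee_observations:
  assumes "is_dsee N (explore p v) S \<pi>" "\<omega> \<in> space M"
  shows "observations (explore p v (t - 1)) (history_at \<pi> U X t \<omega>) n = explored p v N (t - 1) n"
proof -
  have "fst (history_at \<pi> U X t \<omega> s) = cyclic_index (card (explore p v s)) N"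
    if s: "s \<in> explore p v (t - 1)" for s
  proof -
    have st: "1 \<le> s" "s \<le> t - 1" using explore_subset[of p v "t - 1"] s by auto
    have "s \<in> explore p v s" using s st explore_mem_iff by blast
    then show ?thesis using st dsee_explore_arm[OF assms(1) st(1) _ assms(2)]
      by (auto simp: history_at_def)
  qed
  then show ?thesis by (auto simp: observations_def explored_def)
qed

lemma dsee_sample_mean:
  assumes "is_dsee N (explore p v) S \<pi>" "\<omega> \<in> space M"
  shows "sample_mean (explore p v (t - 1)) (history_at \<pi> U X t \<omega>) n =
    estimate (explored p v N (t - 1) n) n \<omega>"
proof -
  have "snd (history_at \<pi> U X t \<omega> s) = X n s \<omega>" if s: "s \<in> explored p v N (t - 1) n" for s
  proof -
    have st: "1 \<le> s" "s \<le> t - 1" using explore_subset[of p v "t - 1"] s by (auto simp: explored_def)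
    have "s \<in> explore p v s" using s st explore_mem_iff[of s "t - 1" p v] by (simp add: explored_def)
    then show ?thesis using st s dsee_explore_arm[OF assms(1) st(1) _ assms(2)]
      by (auto simp: history_at_def explored_def)
  qed
  then show ?thesis
    unfolding sample_mean_def estimate_def dsee_observations[OF assms] by simp
qed

text \<open>If all estimates err by less than \<epsilon>, maximizing them loses less than
  \<open>2 * \<epsilon>\<close> in the mean, which is smaller than any positive gap.\<close>

lemma dsee_exploit_optimal:
  assumes dsee: "is_dsee N (explore p v) S \<pi>" and \<omega>: "\<omega> \<in> space M" and t: "t \<ge> 1" "t \<notin> explore p v t"
    and b: "b \<in> {1..N}"
    and gap: "\<And>n. n \<in> {1..N} \<Longrightarrow> arm_mean f n < arm_mean f b \<Longrightarrow> 2 * \<epsilon> \<le> arm_mean f b - arm_mean f n"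
    and ne: "\<And>n. n \<in> {1..N} \<Longrightarrow> explored p v N (t - 1) n \<noteq> {}"
    and good: "\<And>n. n \<in> {1..N} \<Longrightarrow> \<bar>estimate (explored p v N (t - 1) n) n \<omega> - arm_mean f n\<bar> < \<epsilon>"
  shows "arm_mean f b \<le> arm_mean f (arm_at \<pi> U X t \<omega>)"
proof -
  let ?h = "history_at \<pi> U X t \<omega>" and ?a = "arm_at \<pi> U X t \<omega>"
  have pol: "is_policy N S \<pi>" using dsee by (simp add: is_dsee_def)
  have a: "?a \<in> {1..N}" using measurable_space[OF arm_at_random_variable[OF pol t(1)] \<omega>] by simp
  have "U \<omega> \<in> space S" using measurable_space[OF seed_measurable \<omega>] .
  then obtain m where m: "\<forall>n\<in>{1..N}. observations (explore p v (t - 1)) ?h n \<noteq> {} \<longrightarrow>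
        m n = sample_mean (explore p v (t - 1)) ?h n" "\<forall>n\<in>{1..N}. m n \<le> (m ?a :: real)"
    using dsee t history_at_space[of \<pi> U X t \<omega>] unfolding is_dsee_def arm_at_eq by (metis (no_types, lifting))
  \<comment> \<open>Nonemptiness removes the freedom that \<open>m\<close> has on unobserved
    arms.\<close>
  have est: "m n = estimate (explored p v N (t - 1) n) n \<omega>" if "n \<in> {1..N}" for n
    using m(1) that ne[OF that] unfolding dsee_observations[OF dsee \<omega>] dsee_sample_mean[OF dsee \<omega>] by blast
  have "m b \<le> m ?a" using m(2) b by blast
  then have "arm_mean f b - arm_mean f ?a < 2 * \<epsilon>"
    using good[OF a] good[OF b] unfolding est[OF a] est[OF b] by linarith
  then show ?thesis using gap[OF a] by linarith
qed

text \<open>Once every arm has been observed, playing a suboptimal arm forces some estimate to err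
  by at least \<epsilon>, and a union bound over arms applies. Optimal arms contribute zero.\<close>

lemma dsee_exploit_regret:
  assumes p: "p > 1" and v: "v > 0" and N: "N \<ge> 1"
    and int: "\<And>n. n \<in> {1..N} \<Longrightarrow> integrable (f n) (\<lambda>x. \<bar>x\<bar> powr p)"
    and B: "\<And>n. n \<in> {1..N} \<Longrightarrow> (\<integral>x. \<bar>x - arm_mean f n\<bar> powr p \<partial>f n) \<le> B"
    and K: "moment_const p B \<ge> 0"
    and dsee: "is_dsee N (explore p v) S \<pi>" and t: "t > 1" "t \<notin> explore p v t"
    and b: "b \<in> {1..N}" and best: "\<And>n. n \<in> {1..N} \<Longrightarrow> arm_mean f n \<le> arm_mean f b" and \<epsilon>: "\<epsilon> > 0"
    and gap: "\<And>n. n \<in> {1..N} \<Longrightarrow> arm_mean f n < arm_mean f b \<Longrightarrow> 2 * \<epsilon> \<le> arm_mean f b - arm_mean f n"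
  shows "(\<Sum>n=1..N. (arm_mean f b - arm_mean f n) * prob {\<omega> \<in> space M. arm_at \<pi> U X t \<omega> = n}) \<le>
    (\<Sum>n=1..N. arm_mean f b - arm_mean f n) * (error_const p v N B \<epsilon> * real t powr (explore_exponent p - 1))"
proof -
  define e where "e = moment_exponent p - p"
  \<comment> \<open>The threshold of the exploration test that failed at \<open>t\<close>; at least
    \<open>x\<close> exploration times precede \<open>t\<close>.\<close>
  define x where "x = v * real t powr explore_exponent p"
  define c where "c = moment_const p B * \<epsilon> powr (- p)"
  have c: "c \<ge> 0" using K by (simp add: c_def)
  have e: "e \<le> 0" using p by (auto simp: e_def moment_exponent_def)
  have x: "x > 0" using v t by (simp add: x_def)
  have "x / (2 * real N) = v / (2 * real N) * real t powr explore_exponent p" by (simp add: x_def)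
  then have "(x / (2 * real N)) powr e = (v / (2 * real N)) powr e * real t powr (explore_exponent p * e)"
    using v by (simp only: powr_mult powr_powr)
  then have const: "(1 + real N * c) * (x / (2 * real N)) powr e =
      error_const p v N B \<epsilon> * real t powr (explore_exponent p - 1)"
    by (simp add: error_const_def explore_exponent_moment[OF p] e_def c_def)
  have pr: "prob {\<omega> \<in> space M. arm_at \<pi> U X t \<omega> = n} \<le> (1 + real N * c) * (x / (2 * real N)) powr e"
    if n: "n \<in> {1..N}" and sub: "arm_mean f n < arm_mean f b" for n
  proof (cases "x < real N")
    case True
    \<comment> \<open>Some arms may still be unobserved; here the claimed bound is at least \<open>1\<close>.\<close>
    then have "1 powr e \<le> (x / (2 * real N)) powr e" using x e by (intro powr_mono2') auto
    then have "1 * 1 \<le> (1 + real N * c) * (x / (2 * real N)) powr e" using c by (intro mult_mono) auto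
    then show ?thesis using prob_le_1[of "{\<omega> \<in> space M. arm_at \<pi> U X t \<omega> = n}"] by linarith
  next
    case False
    let ?I = "explored p v N (t - 1)"
    let ?bad = "\<lambda>n. {\<omega> \<in> space M. \<bar>estimate (?I n) n \<omega> - arm_mean f n\<bar> \<ge> \<epsilon>}"
    define k where "k = card (explore p v (t - 1))"
    have k: "x \<le> real k" using card_explore_ge[OF t] by (simp add: x_def k_def)
    have card: "x / (2 * real N) \<le> real (card (?I n))" if "n \<in> {1..N}" for n
    proof -
      have kN: "N \<le> k" using k False by simp
      then have 1: "1 \<le> k div N" using N by (simp add: Suc_le_eq div_greater_zero_iff)
      \<comment> \<open>With at least one complete round, the incomplete one at most doubles the
        count; this is the origin of the \<open>2\<close> in \<open>v / (2 * N)\<close>.\<close>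
      have "k = N * (k div N) + k mod N" by simp
      also have "\<dots> \<le> N * (k div N) + N * (k div N)"
      proof (rule add_left_mono)
        have "k mod N \<le> N * 1" using N by (simp add: less_imp_le)
        also have "\<dots> \<le> N * (k div N)" using 1 by (rule mult_le_mono2)
        finally show "k mod N \<le> N * (k div N)" .
      qed
      finally have "k \<le> 2 * N * (k div N)" by simp
      then have "real k \<le> 2 * real N * real (k div N)" by (metis of_nat_le_iff of_nat_mult of_nat_numeral)
      moreover have "real (k div N) \<le> real (card (?I n))"
        using card_explored_ge[OF that, of p v "t - 1"] by (simp add: k_def)
      ultimately have "real k \<le> 2 * real N * real (card (?I n))"
        by (meson mult_left_mono order.trans of_nat_0_le_iff mult_nonneg_nonneg zero_le_numeral)
      then show ?thesis using k N by (simp add: field_simps)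
    qed
    have xN: "0 < x / (2 * real N)" using x N by simp
    have ne: "?I n \<noteq> {}" if "n \<in> {1..N}" for n using card[OF that] xN by auto
    have sub1: "?I n \<subseteq> {1..}" and fin: "finite (?I n)" for n
      using explore_subset[of p v "t - 1"] by (auto simp: explored_def)
    have bad: "prob (?bad n) \<le> c * (x / (2 * real N)) powr e" if n: "n \<in> {1..N}" for n
    proof -
      have "prob (?bad n) \<le> c * real (card (?I n)) powr e"
        unfolding c_def e_def by (rule estimate_tail[OF p n int[OF n] B[OF n] fin ne[OF n] sub1 \<epsilon>])
      also have "\<dots> \<le> c * (x / (2 * real N)) powr e"
        using c e xN card[OF n] by (intro mult_left_mono powr_mono2') auto
      finally show ?thesis .
    qed
    have meas: "?bad n \<in> events" if n: "n \<in> {1..N}" for n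
    proof -
      have [measurable]: "estimate (?I n) n \<in> borel_measurable M"
        unfolding estimate_def using sub1 n
        by (intro borel_measurable_divide borel_measurable_sum reward_measurable) auto
      show ?thesis by measurable
    qed
    have "{\<omega> \<in> space M. arm_at \<pi> U X t \<omega> = n} \<subseteq> (\<Union>n\<in>{1..N}. ?bad n)"
    proof (rule subsetI, rule ccontr)
      fix \<omega> assume w: "\<omega> \<in> {\<omega> \<in> space M. arm_at \<pi> U X t \<omega> = n}" and nb: "\<omega> \<notin> (\<Union>n\<in>{1..N}. ?bad n)"
      then have \<omega>: "\<omega> \<in> space M" by simp
      have "arm_mean f b \<le> arm_mean f (arm_at \<pi> U X t \<omega>)"
        using t nb \<omega> by (intro dsee_exploit_optimal[OF dsee \<omega> _ _ b gap ne]) (auto simp: not_le)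
      then show False using w sub by simp
    qed
    then have "prob {\<omega> \<in> space M. arm_at \<pi> U X t \<omega> = n} \<le> prob (\<Union>n\<in>{1..N}. ?bad n)"
      using meas by (intro finite_measure_mono sets.finite_UN) auto
    also have "\<dots> \<le> (\<Sum>n=1..N. prob (?bad n))"
      using meas by (intro finite_measure_subadditive_finite) auto
    also have "\<dots> \<le> (\<Sum>n=1..N. c * (x / (2 * real N)) powr e)" by (intro sum_mono bad) auto
    also have "\<dots> \<le> (1 + real N * c) * (x / (2 * real N)) powr e" by (simp add: algebra_simps)
    finally show ?thesis .
  qed
  have "(\<Sum>n=1..N. (arm_mean f b - arm_mean f n) * prob {\<omega> \<in> space M. arm_at \<pi> U X t \<omega> = n}) \<le>
     (\<Sum>n=1..N. (arm_mean f b - arm_mean f n) * ((1 + real N * c) * (x / (2 * real N)) powr e))"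
  proof (rule sum_mono)
    fix n assume n: "n \<in> {1..N}"
    show "(arm_mean f b - arm_mean f n) * prob {\<omega> \<in> space M. arm_at \<pi> U X t \<omega> = n} \<le>
      (arm_mean f b - arm_mean f n) * ((1 + real N * c) * (x / (2 * real N)) powr e)"
    proof (cases "arm_mean f n < arm_mean f b")
      case True
      then show ?thesis using pr[OF n True] by (intro mult_left_mono) auto
    next
      case False
      then have "arm_mean f n = arm_mean f b" using best[OF n] by simp
      then show ?thesis by simp
    qed
  qed
  then show ?thesis by (simp only: const sum_distrib_right)
qed

text \<open>The sum of all gaps bounds the loss at any single time. It is charged at exploration
  times and at time 1, which is neither explored nor covered by \<open>card_explore_ge\<close>. The
  \<open>2\<close> in the constant collects time 1 and the overshoot in
  \<open>card_explore_le\<close>.\<close>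

lemma dsee_regret_le:
  assumes p: "p > 1" and v: "v > 0" and N: "N \<ge> 1"
    and int: "\<And>n. n \<in> {1..N} \<Longrightarrow> integrable (f n) (\<lambda>x. \<bar>x\<bar> powr p)"
    and B: "\<And>n. n \<in> {1..N} \<Longrightarrow> (\<integral>x. \<bar>x - arm_mean f n\<bar> powr p \<partial>f n) \<le> B"
    and K: "moment_const p B \<ge> 0"
    and dsee: "is_dsee N (explore p v) S \<pi>"
    and b: "b \<in> {1..N}" and best: "\<And>n. n \<in> {1..N} \<Longrightarrow> arm_mean f n \<le> arm_mean f b" and \<epsilon>: "\<epsilon> > 0"
    and gap: "\<And>n. n \<in> {1..N} \<Longrightarrow> arm_mean f n < arm_mean f b \<Longrightarrow> 2 * \<epsilon> \<le> arm_mean f b - arm_mean f n"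
  shows "regret M U X (arm_mean f b) \<pi> T \<le>
    (\<Sum>n=1..N. arm_mean f b - arm_mean f n) * (v + 2 + error_const p v N B \<epsilon> / explore_exponent p) *
      real T powr explore_exponent p"
\<comment> \<open>Absorbing the additive constants needs
  \<open>1 \<le> real T powr \<alpha>\<close>, which fails for \<open>T = 0\<close>.\<close>
proof (cases "T = 0")
  case True
  then show ?thesis by (simp add: regret_def)
next
  case False
  define \<Delta> where "\<Delta> = (\<Sum>n=1..N. arm_mean f b - arm_mean f n)"
  define Q where "Q = error_const p v N B \<epsilon>"
  define \<alpha> where "\<alpha> = explore_exponent p"
  have pol: "is_policy N S \<pi>" using dsee by (simp add: is_dsee_def)
  have \<alpha>: "0 < \<alpha>" "\<alpha> \<le> 1"
    unfolding \<alpha>_def using explore_exponent_pos[OF p] explore_exponent_le[OF p] by auto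
  have \<Delta>: "\<Delta> \<ge> 0" unfolding \<Delta>_def using best by (intro sum_nonneg) auto
  have Q: "Q \<ge> 0" using K by (simp add: Q_def error_const_def)
  let ?r = "\<lambda>t. \<Sum>n=1..N. (arm_mean f b - arm_mean f n) * prob {\<omega> \<in> space M. arm_at \<pi> U X t \<omega> = n}"
  have triv: "?r t \<le> \<Delta>" for t
    unfolding \<Delta>_def using best by (intro sum_mono) (simp add: mult_left_le)
  have "regret M U X (arm_mean f b) \<pi> T = (\<Sum>t=1..T. ?r t)" by (rule regret_eq[OF pol])
  also have "\<dots> \<le> (\<Sum>t=1..T. (if t \<in> explore p v T then \<Delta> else 0) + (if t = 1 then \<Delta> else 0) +
      \<Delta> * Q * real t powr (\<alpha> - 1))"
  proof (rule sum_mono)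
    fix t assume t: "t \<in> {1..T}"
    have nn: "0 \<le> \<Delta> * Q * real t powr (\<alpha> - 1)" using \<Delta> Q by simp
    show "?r t \<le> (if t \<in> explore p v T then \<Delta> else 0) + (if t = 1 then \<Delta> else 0) +
      \<Delta> * Q * real t powr (\<alpha> - 1)"
    proof (cases "t \<in> explore p v T \<or> t = 1")
      case True
      then show ?thesis using triv[of t] nn \<Delta> by auto
    next
      case False
      have "t \<notin> explore p v t" using False t explore_mem_iff[of t T p v] by simp
      then have "?r t \<le> \<Delta> * (Q * real t powr (\<alpha> - 1))"
        unfolding \<Delta>_def Q_def \<alpha>_def using False t
        by (intro dsee_exploit_regret[OF p v N int B K dsee _ _ b best \<epsilon> gap]) auto
      then show ?thesis using False by (simp add: mult.assoc)
    qed
  qed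
  also have "\<dots> = \<Delta> * real (card (explore p v T)) + \<Delta> + \<Delta> * Q * (\<Sum>t=1..T. real t powr (\<alpha> - 1))"
  proof -
    have "(\<Sum>t=1..T. if t \<in> explore p v T then \<Delta> else 0) = (\<Sum>t\<in>{1..T} \<inter> explore p v T. \<Delta>)"
      by (rule sum.inter_restrict[symmetric]) simp
    also have "{1..T} \<inter> explore p v T = explore p v T" using explore_subset[of p v T] by auto
    finally have "(\<Sum>t=1..T. if t \<in> explore p v T then \<Delta> else 0) = \<Delta> * real (card (explore p v T))" by simp
    moreover have "(\<Sum>t=1..T. if t = 1 then \<Delta> else 0) = \<Delta>" using False by simp
    ultimately show ?thesis by (simp only: sum.distrib sum_distrib_left)
  qed
  also have "\<dots> \<le> \<Delta> * (v * real T powr \<alpha> + 1) + \<Delta> + \<Delta> * Q * (real T powr \<alpha> / \<alpha>)"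
    using card_explore_le[OF p v, of T] sum_powr_le[OF \<alpha>, of T] \<Delta> Q
    by (intro add_mono mult_left_mono) (auto simp: \<alpha>_def)
  also have "\<dots> = \<Delta> * (v * real T powr \<alpha> + 2 + Q / \<alpha> * real T powr \<alpha>)" by (simp add: algebra_simps)
  also have "\<dots> \<le> \<Delta> * (v * real T powr \<alpha> + 2 * real T powr \<alpha> + Q / \<alpha> * real T powr \<alpha>)"
  proof -
    have "1 \<le> real T powr \<alpha>" using False \<alpha> by (intro ge_one_powr_ge_zero) auto
    then show ?thesis using \<Delta> by (intro mult_left_mono) auto
  qed
  also have "\<dots> = \<Delta> * (v + 2 + Q / \<alpha>) * real T powr \<alpha>" by (simp add: algebra_simps)
  finally show ?thesis by (simp only: \<Delta>_def Q_def \<alpha>_def)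
qed

end

theorem theorem3:
  fixes N :: nat and f :: "nat \<Rightarrow> real measure" and \<sigma> :: "nat \<Rightarrow> nat" and p v :: real
  assumes "N \<ge> 2"
    and "\<And>n. n \<in> {1..N} \<Longrightarrow> prob_space (f n)"
    and "\<And>n. n \<in> {1..N} \<Longrightarrow> sets (f n) = sets borel"
    and "\<sigma> permutes {1..N}"
    and "\<And>i j. 1 \<le> i \<Longrightarrow> i \<le> j \<Longrightarrow> j \<le> N \<Longrightarrow> arm_mean f (\<sigma> j) \<le> arm_mean f (\<sigma> i)"
    and "p > 1"
    and "\<And>n. n \<in> {1..N} \<Longrightarrow> integrable (f n) (\<lambda>x. \<bar>x\<bar> powr p)"
    and "v > 0"
  shows "\<exists>g \<in> O(\<lambda>T. if p \<le> 2 then real T powr (1 / p) else real T powr (1 / (1 + p / 2))).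
    \<forall>(M :: 'a measure) (S :: 'u measure) U X \<pi>.
      bandit M S U N f X \<and> is_dsee N (explore p v) S \<pi> \<longrightarrow>
        (\<forall>T. regret M U X (arm_mean f (\<sigma> 1)) \<pi> T \<le> g T)"
proof -
  define b where "b = \<sigma> 1"
  \<comment> \<open>The sum serves as a common bound for the central moments of all arms.\<close>
  define B where "B = (\<Sum>n=1..N. \<integral>x. \<bar>x - arm_mean f n\<bar> powr p \<partial>f n)"
  \<comment> \<open>Half the smallest positive gap, capped at \<open>1 / 2\<close>; the inserted
    \<open>1\<close> keeps the set nonempty when all arms are optimal.\<close>
  define \<epsilon> where "\<epsilon> = Min (insert 1 {arm_mean f b - arm_mean f n |n. n \<in> {1..N} \<and> arm_mean f n < arm_mean f b}) / 2"
  have b: "b \<in> {1..N}" unfolding b_def using assms(1) permutes_in_image[OF assms(4), of 1] by simp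
  have best: "arm_mean f n \<le> arm_mean f b" if n: "n \<in> {1..N}" for n
  proof -
    obtain j where "j \<in> {1..N}" "n = \<sigma> j" using n permutes_image[OF assms(4)] by blast
    then show ?thesis using assms(5)[of 1 j] by (simp add: b_def)
  qed
  have fin: "finite (insert 1 {arm_mean f b - arm_mean f n |n. n \<in> {1..N} \<and> arm_mean f n < arm_mean f b})"
    by (rule finite.insertI, rule finite_subset[of _ "(\<lambda>n. arm_mean f b - arm_mean f n) ` {1..N}"]) auto
  have \<epsilon>: "\<epsilon> > 0" unfolding \<epsilon>_def using fin by (subst zero_less_divide_iff) (auto simp: Min_gr_iff)
  have gap: "2 * \<epsilon> \<le> arm_mean f b - arm_mean f n"
    if "n \<in> {1..N}" "arm_mean f n < arm_mean f b" for n
    unfolding \<epsilon>_def using fin that by (auto intro!: Min_le)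
  have B: "(\<integral>x. \<bar>x - arm_mean f n\<bar> powr p \<partial>f n) \<le> B" if "n \<in> {1..N}" for n
    unfolding B_def using that
    by (intro member_le_sum[where f="\<lambda>n. \<integral>x. \<bar>x - arm_mean f n\<bar> powr p \<partial>f n"]) auto
  have "B \<ge> 0" unfolding B_def by (intro sum_nonneg) simp
  then have K: "moment_const p B \<ge> 0" by (rule moment_const_nonneg[OF assms(6)])
  \<comment> \<open>Fixed before any probability space or policy is introduced, so the same bound
    serves all of them.\<close>
  define c where "c = (\<Sum>n=1..N. arm_mean f b - arm_mean f n) *
      (v + 2 + error_const p v N B \<epsilon> / explore_exponent p)"
  have rate: "(\<lambda>T. if p \<le> 2 then real T powr (1 / p) else real T powr (1 / (1 + p / 2))) =
      (\<lambda>T. real T powr explore_exponent p)" by (auto simp: explore_exponent_def)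
  have N1: "N \<ge> 1" using assms(1) by simp
  show ?thesis
  proof (rule bexI[of _ "\<lambda>T. c * real T powr explore_exponent p"], intro allI impI, elim conjE)
    fix M :: "'a measure" and S :: "'u measure" and U X \<pi> T
    assume "bandit M S U N f X" and dsee: "is_dsee N (explore p v) S \<pi>"
    then interpret bandit M S U N f X by simp
    show "regret M U X (arm_mean f (\<sigma> 1)) \<pi> T \<le> c * real T powr explore_exponent p"
      unfolding c_def b_def[symmetric]
      by (rule dsee_regret_le[OF assms(6,8) N1 assms(7) B K dsee b best \<epsilon> gap])
  qed (simp add: rate)
qed

end
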